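(* Let $(\mathbb P^{s,x})_{(s,x)\in[0,T]\times E}$ be a Markov canonical class, associated to a transition function measurable in time, which solves a well-posed Martingale Problem associated to some $(\mathcal D(a),a)$. Let $f\in\mathcal B([0,T]\times E\times\mathbb R\times\mathbb R,\mathbb R)$ and $g\in\mathcal B(E,\mathbb R)$ be such that, for some constant $C>0$: $g(X_T)\in L^2(\mathbb P^{s,x})$ for all $(s,x)\in[0,T]\times E$; $f(\cdot,\cdot,0,0)\in\mathcal L^2_X$; and $|f(t,x,y,z)|\le |f(t,x,0,0)|+C(|y|+|z|)$ for all $(t,x,y,z)$. Let $u\in\mathcal L^2_X$ be a martingale solution of $Pseudo\text{-}PDE(f,g)$. Then $(u,\mathfrak G(u)^{1/2})$ is a solution of $IP(f,g)$; in particular $u$ is a decoupled mild solution of $Pseudo\text{-}PDE(f,g)$.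
   Context: Let $T\in(0,\infty)$ and let $E$ be a Polish space. $\mathcal B(F,G)$ denotes the set of Borel functions $F\to G$. $\Omega=\mathbb D([0,T],E)$ is the space of functions $[0,T]\to E$ that are right-continuous with left limits and continuous at time $T$; $X_t(\omega)=\omega(t)$; $\mathcal F=\sigma(X_r:r\in[0,T])$; $\mathcal F_t=\bigcap_{s\in(t,T]}\sigma(X_r:r\le s)$ for $t<T$, and $\mathcal F_T=\mathcal F$. A transition function is a map $p:[0,T]\times E\times[0,T]\times\mathcal B(E)\to[0,1]$ such that $x\mapsto p(s,x,t,A)$ is Borel, $p(s,x,t,\cdot)$ is a probability measure, $p(s,x,t,A)=1_A(x)$ if $t\le s$, and $\int_E p(s,x,t,dy)p(t,y,u,A)=p(s,x,u,A)$ if $s<t<u$. It is measurable in time if $(s,x)\mapsto p(s,x,t,A)$ is Borel for all $t,A$. A Markov canonical class associated to $p$ is a family of probability measures $(\mathbb P^{s,x})_{(s,x)\in[0,T]\times E}$ on $(\Omega,\mathcal F)$ with $\mathbb P^{s,x}(X_t\in A)=p(s,x,t,A)$ and, for $s\le t\le u$, $\mathbb P^{s,x}(X_u\in A|\mathcal F_t)=p(t,X_t,u,A)$ $\mathbb P^{s,x}$-a.s. $\mathbb E^{s,x}$ is the expectation under $\mathbb P^{s,x}$. Under $\mathbb P^{s,x}$ one works on the stochastic basis obtained by completing $\mathcal F$ and all $\mathcal F_t$ with the $\mathbb P^{s,x}$-negligible sets. Martingale Problem: $\mathcal D(a)\subset\mathcal B([0,T]\times E,\mathbb R)$ is a linear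 algebra and $a:\mathcal D(a)\to\mathcal B([0,T]\times E,\mathbb R)$ is linear. $(\mathbb P^{s,x})$ solves the Martingale Problem associated to $(\mathcal D(a),a)$ if for every $(s,x)$: (a) $\mathbb P^{s,x}(\forall t\in[0,s],X_t=x)=1$; (b) for every $\phi\in\mathcal D(a)$, $\phi(\cdot,X_\cdot)-\int_s^\cdot a(\phi)(r,X_r)dr$ on $[s,T]$ is a càdlàg $(\mathbb P^{s,x},(\mathcal F_t)_{t\in[s,T]})$-local martingale. It is well-posed if for each $(s,x)$, $\mathbb P^{s,x}$ is the only probability satisfying (a) and (b). $\mathcal L^p_X$ ($p\geq 1$) is the set of $\phi\in\mathcal B([0,T]\times E,\mathbb R)$ with $\mathbb E^{s,x}[\int_s^T|\phi(r,X_r)|^pdr]<\infty$ for every $(s,x)\in[0,T]\times E$. A Borel set $A\subset[0,T]\times E$ is of zero potential if $\mathbb E^{s,x}[\int_s^T1_{\{(t,X_t)\in A\}}dt]=0$ for all $(s,x)$. $\mathcal H^2_0$ is the space of càdlàg martingales $M$ starting at $0$ with $\sup_t|M_t|\in L^2$; $\langle M\rangle$ is the predictable angular bracket. Extended operators: $\mathcal D(\mathfrak a)$ is the set of $\phi\in\mathcal B([0,T]\times E,\mathbb R)$ for which there is $\psi\in\mathcal B([0,T]\times E,\mathbb R)$ such that under every $\mathbb P^{s,x}$ the process $1_{[s,T]}\big(\phi(\cdot,X_\cdot)-\phi(s,x)-\int_s^\cdot\psi(r,X_r)dr\big)$ has a càdlàg modification in $\mathcal H^2_0$, denoted $M[\phi]^{s,x}$.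 Such $\psi$ is unique up to zero potential sets and one sets $\mathfrak a(\phi):=\psi$. For $\phi\in\mathcal D(\mathfrak a)$, $\mathfrak G(\phi)$ is the (unique up to zero potential sets, chosen nonnegative) Borel function such that under every $\mathbb P^{s,x}$, $\langle M[\phi]^{s,x}\rangle=\int_s^\cdot\mathfrak G(\phi)(r,X_r)dr$ on $[s,T]$. $Pseudo\text{-}PDE(f,g)$ is the equation $a(u)+f(\cdot,\cdot,u,\Gamma(u)^{1/2})=0$ on $[0,T]\times E$, $u(T,\cdot)=g$, where $\Gamma(u)=a(u^2)-2ua(u)$. A martingale solution is a function $u\in\mathcal D(\mathfrak a)$ such that $\mathfrak a(u)=-f(\cdot,\cdot,u,\mathfrak G(u)^{1/2})$ up to zero potential sets and $u(T,\cdot)=g$. $P_{s,t}[\phi](x):=\mathbb E^{s,x}[\phi(X_t)]$ for $s\le t$, when the expectation is finite. A pair $(u,v)$ of Borel functions on $[0,T]\times E$ with $v\ge0$ is a solution of $IP(f,g)$ (identification problem) if $u,v\in\mathcal L^2_X$ and for every $(s,x)\in[0,T]\times E$, $$u(s,x)=P_{s,T}[g](x)+\int_s^TP_{s,r}[f(r,\cdot,u(r,\cdot),v(r,\cdot))](x)dr,$$ $$u^2(s,x)=P_{s,T}[g^2](x)-\int_s^TP_{s,r}[v^2(r,\cdot)-2u(r,\cdot)f(r,\cdot,u(r,\cdot),v(r,\cdot))](x)dr.$$ $u$ is a decoupled mild solution of $Pseudo\text{-}PDE(f,g)$ if there is $v$ such that $(u,v)$ solves $IP(f,g)$. *)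

theory Defs
  imports "HOL-Probability.Probability"
begin

section \<open>Canonical space\<close>

definition cadlag_on :: "real \<Rightarrow> real \<Rightarrow> (real \<Rightarrow> 'a::topological_space) \<Rightarrow> bool" where
  "cadlag_on a b h \<longleftrightarrow>
     (\<forall>t\<in>{a..<b}. (h \<longlongrightarrow> h t) (at_right t)) \<and>
     (\<forall>t\<in>{a<..b}. \<exists>l. (h \<longlongrightarrow> l) (at_left t))"

text \<open>A path on \<open>[0,T]\<close> is encoded as a function on \<open>real\<close> that is \<open>undefined\<close> off \<open>[0,T]\<close>.
  The canonical process is evaluation: \<open>X\<^sub>t(\<omega>) = \<omega> t\<close>.\<close>

definition paths :: "real \<Rightarrow> (real \<Rightarrow> 'e::polish_space) set" where
  "paths T = {\<omega> \<in> extensional {0..T}. cadlag_on 0 T \<omega> \<and> (\<omega> \<longlongrightarrow> \<omega> T) (at_left T)}"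

definition coord_algebra :: "real \<Rightarrow> real set \<Rightarrow> (real \<Rightarrow> 'e::polish_space) measure" where
  "coord_algebra T I =
     sigma (paths T) {{\<omega> \<in> paths T. \<omega> r \<in> A} | r A. r \<in> I \<and> A \<in> sets borel}"

definition canonical_algebra :: "real \<Rightarrow> (real \<Rightarrow> 'e::polish_space) measure" where
  "canonical_algebra T = coord_algebra T {0..T}"

text \<open>Indexed by all of \<open>real\<close> so that the library notion \<open>stopping_time\<close> applies.
  Only times in \<open>[0,T]\<close> matter.\<close>

definition canonical_filtration :: "real \<Rightarrow> real \<Rightarrow> (real \<Rightarrow> 'e::polish_space) measure" where
  "canonical_filtration T t =
     (if t < T then sigma (paths T) (\<Inter>s\<in>{t<..T}. sets (coord_algebra T {0..s}))
      else canonical_algebra T)"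

text \<open>The completed stochastic basis under \<open>Q\<close> is \<open>completion Q\<close> with this filtration:
  \<open>null_sets (completion Q)\<close> consists of all \<open>Q\<close>-negligible sets.\<close>

definition completed_filtration ::
  "real \<Rightarrow> (real \<Rightarrow> 'e::polish_space) measure \<Rightarrow> real \<Rightarrow> (real \<Rightarrow> 'e) measure" where
  "completed_filtration T Q t =
     sigma (space Q) (sets (canonical_filtration T t) \<union> null_sets (completion Q))"

text \<open>Borel functions on \<open>[0,T] \<times> 'a\<close>, encoded by their extension by \<open>0\<close> to \<open>real \<times> 'a\<close>.
  The encoding is one-to-one and compatible with pointwise sums and products.\<close>

definition borel_fun :: "real \<Rightarrow> (real \<times> 'a::topological_space \<Rightarrow> real) set" where
  "borel_fun T =
     {\<phi> \<in> borel_measurable borel. \<forall>t y. t \<notin> {0..T} \<longrightarrow> \<phi> (t, y) = 0}"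

definition path_integral ::
  "(real \<times> 'e \<Rightarrow> real) \<Rightarrow> real \<Rightarrow> real \<Rightarrow> (real \<Rightarrow> 'e) \<Rightarrow> real" where
  "path_integral \<psi> s t \<omega> = (LINT r:{s..t}|lborel. \<psi> (r, \<omega> r))"

definition path_integrable ::
  "(real \<times> 'e \<Rightarrow> real) \<Rightarrow> real \<Rightarrow> real \<Rightarrow> (real \<Rightarrow> 'e) \<Rightarrow> bool" where
  "path_integrable \<psi> s t \<omega> \<longleftrightarrow> set_integrable lborel {s..t} (\<lambda>r. \<psi> (r, \<omega> r))"


section \<open>Transition functions and Markov canonical classes\<close>

definition transition_function ::
  "real \<Rightarrow> (real \<Rightarrow> 'e::polish_space \<Rightarrow> real \<Rightarrow> 'e measure) \<Rightarrow> bool" where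
  "transition_function T p \<longleftrightarrow>
     (\<forall>s\<in>{0..T}. \<forall>t\<in>{0..T}.
        (\<forall>A\<in>sets borel. (\<lambda>x. measure (p s x t) A) \<in> borel_measurable borel) \<and>
        (\<forall>x. prob_space (p s x t) \<and> sets (p s x t) = sets borel) \<and>
        (t \<le> s \<longrightarrow> (\<forall>x. \<forall>A\<in>sets borel. measure (p s x t) A = indicator A x))) \<and>
     (\<forall>s t u. 0 \<le> s \<and> s < t \<and> t < u \<and> u \<le> T \<longrightarrow>
        (\<forall>x. \<forall>A\<in>sets borel. (LINT y|p s x t. measure (p t y u) A) = measure (p s x u) A))"

definition measurable_in_time ::
  "real \<Rightarrow> (real \<Rightarrow> 'e::polish_space \<Rightarrow> real \<Rightarrow> 'e measure) \<Rightarrow> bool" where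
  "measurable_in_time T p \<longleftrightarrow>
     (\<forall>t\<in>{0..T}. \<forall>A\<in>sets borel.
        (\<lambda>(s, x). measure (p s x t) A) \<in> borel_measurable (restrict_space borel ({0..T} \<times> UNIV)))"

definition canonical_prob :: "real \<Rightarrow> (real \<Rightarrow> 'e::polish_space) measure \<Rightarrow> bool" where
  "canonical_prob T Q \<longleftrightarrow> prob_space Q \<and> sets Q = sets (canonical_algebra T)"

definition markov_canonical_class ::
  "real \<Rightarrow> (real \<Rightarrow> 'e::polish_space \<Rightarrow> real \<Rightarrow> 'e measure)
     \<Rightarrow> (real \<Rightarrow> 'e \<Rightarrow> (real \<Rightarrow> 'e) measure) \<Rightarrow> bool" where
  "markov_canonical_class T p P \<longleftrightarrow>
     (\<forall>s\<in>{0..T}. \<forall>x.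
        canonical_prob T (P s x) \<and>
        (\<forall>t\<in>{0..T}. \<forall>A\<in>sets borel.
           measure (P s x) {\<omega> \<in> paths T. \<omega> t \<in> A} = measure (p s x t) A) \<and>
        (\<forall>t u. s \<le> t \<and> t \<le> u \<and> u \<le> T \<longrightarrow> (\<forall>A\<in>sets borel.
           AE \<omega> in P s x.
             real_cond_exp (P s x) (canonical_filtration T t)
               (indicator {\<omega>' \<in> paths T. \<omega>' u \<in> A}) \<omega> = measure (p t (\<omega> t) u) A)))"


section \<open>Martingales\<close>

definition martingale ::
  "'w measure \<Rightarrow> (real \<Rightarrow> 'w measure) \<Rightarrow> real set \<Rightarrow> (real \<Rightarrow> 'w \<Rightarrow> real) \<Rightarrow> bool" where
  "martingale M F I X \<longleftrightarrow>
     (\<forall>t\<in>I. X t \<in> borel_measurable (F t) \<and> integrable M (X t)) \<and>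
     (\<forall>r\<in>I. \<forall>t\<in>I. r \<le> t \<longrightarrow> (AE \<omega> in M. real_cond_exp M (F r) (X t) \<omega> = X r \<omega>))"

text \<open>On a compact interval \<open>[a,b]\<close>, a localizing sequence is one that almost surely
  reaches \<open>b\<close> after finitely many steps.\<close>

definition local_martingale ::
  "'w measure \<Rightarrow> (real \<Rightarrow> 'w measure) \<Rightarrow> real \<Rightarrow> real \<Rightarrow> (real \<Rightarrow> 'w \<Rightarrow> real) \<Rightarrow> bool" where
  "local_martingale M F a b X \<longleftrightarrow>
     (\<forall>t\<in>{a..b}. X t \<in> borel_measurable (F t)) \<and>
     (\<exists>\<tau> :: nat \<Rightarrow> 'w \<Rightarrow> real.
        (\<forall>n. stopping_time F (\<tau> n)) \<and>
        (\<forall>n. \<forall>\<omega>\<in>space M. a \<le> \<tau> n \<omega> \<and> \<tau> n \<omega> \<le> b \<and> \<tau> n \<omega> \<le> \<tau> (Suc n) \<omega>) \<and>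
        (AE \<omega> in M. \<exists>n. \<tau> n \<omega> = b) \<and>
        (\<forall>n. martingale M F {a..b} (\<lambda>t \<omega>. X (min t (\<tau> n \<omega>)) \<omega>)))"

definition H2_0 ::
  "real \<Rightarrow> (real \<Rightarrow> 'e::polish_space) measure \<Rightarrow> (real \<Rightarrow> (real \<Rightarrow> 'e) \<Rightarrow> real) set" where
  "H2_0 T Q =
     {M. martingale (completion Q) (completed_filtration T Q) {0..T} M \<and>
         (AE \<omega> in completion Q. cadlag_on 0 T (\<lambda>t. M t \<omega>)) \<and>
         (AE \<omega> in completion Q. M 0 \<omega> = 0) \<and>
         (\<integral>\<^sup>+ \<omega>. (SUP t\<in>{0..T}. ennreal ((M t \<omega>)\<^sup>2)) \<partial>completion Q) < \<infinity>}"

definition predictable_algebra ::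
  "real \<Rightarrow> (real \<Rightarrow> 'e::polish_space) measure \<Rightarrow> (real \<times> (real \<Rightarrow> 'e)) measure" where
  "predictable_algebra T Q =
     sigma ({0..T} \<times> space Q)
       ({{0} \<times> A | A. A \<in> sets (completed_filtration T Q 0)} \<union>
        {{r<..t} \<times> A | r t A. 0 \<le> r \<and> r \<le> t \<and> t \<le> T \<and> A \<in> sets (completed_filtration T Q r)})"

text \<open>\<open>A\<close> is a version of the angular bracket of \<open>M\<close>, for \<open>M\<close> in \<open>H2_0\<close>: the predictable
  increasing process, unique up to indistinguishability, with \<open>M\<^sup>2 - A\<close> a martingale.\<close>

definition angle_bracket ::
  "real \<Rightarrow> (real \<Rightarrow> 'e::polish_space) measure
     \<Rightarrow> (real \<Rightarrow> (real \<Rightarrow> 'e) \<Rightarrow> real) \<Rightarrow> (real \<Rightarrow> (real \<Rightarrow> 'e) \<Rightarrow> real) \<Rightarrow> bool" where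
  "angle_bracket T Q M A \<longleftrightarrow>
     (\<lambda>(t, \<omega>). A t \<omega>) \<in> borel_measurable (predictable_algebra T Q) \<and>
     (AE \<omega> in completion Q.
        A 0 \<omega> = 0 \<and> mono_on {0..T} (\<lambda>t. A t \<omega>) \<and> cadlag_on 0 T (\<lambda>t. A t \<omega>)) \<and>
     martingale (completion Q) (completed_filtration T Q) {0..T} (\<lambda>t \<omega>. (M t \<omega>)\<^sup>2 - A t \<omega>)"


section \<open>Martingale problem\<close>

definition linear_algebra_operator ::
  "real \<Rightarrow> (real \<times> 'e::polish_space \<Rightarrow> real) set
     \<Rightarrow> ((real \<times> 'e \<Rightarrow> real) \<Rightarrow> (real \<times> 'e \<Rightarrow> real)) \<Rightarrow> bool" where
  "linear_algebra_operator T D a \<longleftrightarrow>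
     D \<subseteq> borel_fun T \<and>
     (\<lambda>_. 0) \<in> D \<and>
     (\<forall>\<phi>\<in>D. \<forall>\<psi>\<in>D. (\<lambda>z. \<phi> z + \<psi> z) \<in> D \<and> (\<lambda>z. \<phi> z * \<psi> z) \<in> D) \<and>
     (\<forall>c. \<forall>\<phi>\<in>D. (\<lambda>z. c * \<phi> z) \<in> D) \<and>
     (\<forall>\<phi>\<in>D. a \<phi> \<in> borel_fun T) \<and>
     (\<forall>\<phi>\<in>D. \<forall>\<psi>\<in>D. a (\<lambda>z. \<phi> z + \<psi> z) = (\<lambda>z. a \<phi> z + a \<psi> z)) \<and>
     (\<forall>c. \<forall>\<phi>\<in>D. a (\<lambda>z. c * \<phi> z) = (\<lambda>z. c * a \<phi> z))"

text \<open>\<open>Q\<close> satisfies conditions (a) and (b) of the martingale problem started at \<open>(s,x)\<close>.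
  Since \<open>LINT\<close> is \<open>0\<close> on non-integrable functions, the almost sure existence of the
  time integral is stated separately.\<close>

definition mp_solution_at ::
  "real \<Rightarrow> (real \<times> 'e::polish_space \<Rightarrow> real) set
     \<Rightarrow> ((real \<times> 'e \<Rightarrow> real) \<Rightarrow> (real \<times> 'e \<Rightarrow> real))
     \<Rightarrow> real \<Rightarrow> 'e \<Rightarrow> (real \<Rightarrow> 'e) measure \<Rightarrow> bool" where
  "mp_solution_at T D a s x Q \<longleftrightarrow>
     (AE \<omega> in Q. \<forall>t\<in>{0..s}. \<omega> t = x) \<and>
     (\<forall>\<phi>\<in>D.
        (AE \<omega> in completion Q. path_integrable (a \<phi>) s T \<omega>) \<and>
        (AE \<omega> in completion Q. cadlag_on s T (\<lambda>t. \<phi> (t, \<omega> t) - path_integral (a \<phi>) s t \<omega>)) \<and>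
        local_martingale (completion Q) (completed_filtration T Q) s T
          (\<lambda>t \<omega>. \<phi> (t, \<omega> t) - path_integral (a \<phi>) s t \<omega>))"

definition solves_martingale_problem ::
  "real \<Rightarrow> (real \<times> 'e::polish_space \<Rightarrow> real) set
     \<Rightarrow> ((real \<times> 'e \<Rightarrow> real) \<Rightarrow> (real \<times> 'e \<Rightarrow> real))
     \<Rightarrow> (real \<Rightarrow> 'e \<Rightarrow> (real \<Rightarrow> 'e) measure) \<Rightarrow> bool" where
  "solves_martingale_problem T D a P \<longleftrightarrow>
     (\<forall>s\<in>{0..T}. \<forall>x. canonical_prob T (P s x) \<and> mp_solution_at T D a s x (P s x))"

definition well_posed ::
  "real \<Rightarrow> (real \<times> 'e::polish_space \<Rightarrow> real) set
     \<Rightarrow> ((real \<times> 'e \<Rightarrow> real) \<Rightarrow> (real \<times> 'e \<Rightarrow> real))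
     \<Rightarrow> (real \<Rightarrow> 'e \<Rightarrow> (real \<Rightarrow> 'e) measure) \<Rightarrow> bool" where
  "well_posed T D a P \<longleftrightarrow>
     (\<forall>s\<in>{0..T}. \<forall>x. \<forall>Q.
        canonical_prob T Q \<and> mp_solution_at T D a s x Q \<longrightarrow> Q = P s x)"


section \<open>Function spaces and extended operators\<close>

definition LpX ::
  "real \<Rightarrow> (real \<Rightarrow> 'e::polish_space \<Rightarrow> (real \<Rightarrow> 'e) measure)
     \<Rightarrow> real \<Rightarrow> (real \<times> 'e \<Rightarrow> real) set" where
  "LpX T P q =
     {\<phi> \<in> borel_fun T. \<forall>s\<in>{0..T}. \<forall>x.
        (\<integral>\<^sup>+ \<omega>. (\<integral>\<^sup>+ r\<in>{s..T}. ennreal (\<bar>\<phi> (r, \<omega> r)\<bar> powr q) \<partial>lborel) \<partial>P s x) < \<infinity>}"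

definition zero_potential ::
  "real \<Rightarrow> (real \<Rightarrow> 'e::polish_space \<Rightarrow> (real \<Rightarrow> 'e) measure)
     \<Rightarrow> (real \<times> 'e) set \<Rightarrow> bool" where
  "zero_potential T P A \<longleftrightarrow>
     A \<in> sets borel \<and> A \<subseteq> {0..T} \<times> UNIV \<and>
     (\<forall>s\<in>{0..T}. \<forall>x.
        (\<integral>\<^sup>+ \<omega>. (\<integral>\<^sup>+ r\<in>{s..T}. indicator A (r, \<omega> r) \<partial>lborel) \<partial>P s x) = 0)"

text \<open>\<open>M\<close> is a modification in \<open>H2_0\<close> of
  \<open>1\<^bsub>[s,T]\<^esub> (\<phi>(\<cdot>,X) - \<phi>(s,x) - \<integral>\<^sub>s \<psi>(r,X\<^sub>r) dr)\<close> under \<open>Q\<close>.\<close>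

definition martingale_modification ::
  "real \<Rightarrow> (real \<Rightarrow> 'e::polish_space) measure \<Rightarrow> real \<Rightarrow> 'e
     \<Rightarrow> (real \<times> 'e \<Rightarrow> real) \<Rightarrow> (real \<times> 'e \<Rightarrow> real)
     \<Rightarrow> (real \<Rightarrow> (real \<Rightarrow> 'e) \<Rightarrow> real) \<Rightarrow> bool" where
  "martingale_modification T Q s x \<phi> \<psi> M \<longleftrightarrow>
     M \<in> H2_0 T Q \<and>
     (\<forall>t\<in>{0..T}. AE \<omega> in completion Q.
        M t \<omega> = (if s \<le> t then \<phi> (t, \<omega> t) - \<phi> (s, x) - path_integral \<psi> s t \<omega> else 0))"

text \<open>The extended operators are determined only up to sets of zero potential, so they are
  rendered as relations: \<open>ext_generator T P \<phi> \<psi>\<close> says that \<open>\<psi>\<close> is a version of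
  \<open>\<aa>(\<phi>)\<close>, \<open>ext_martingale T P \<phi> s x M\<close> that \<open>M\<close> is a version of \<open>M[\<phi>]\<close> under \<open>P s x\<close>, and
  \<open>ext_carre_du_champ T P \<phi> G\<close> that \<open>G\<close> is a version of \<open>\<GG>(\<phi>)\<close>.\<close>

definition ext_generator ::
  "real \<Rightarrow> (real \<Rightarrow> 'e::polish_space \<Rightarrow> (real \<Rightarrow> 'e) measure)
     \<Rightarrow> (real \<times> 'e \<Rightarrow> real) \<Rightarrow> (real \<times> 'e \<Rightarrow> real) \<Rightarrow> bool" where
  "ext_generator T P \<phi> \<psi> \<longleftrightarrow>
     \<phi> \<in> borel_fun T \<and> \<psi> \<in> borel_fun T \<and>
     (\<forall>s\<in>{0..T}. \<forall>x.
        (AE \<omega> in completion (P s x). path_integrable \<psi> s T \<omega>) \<and>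
        (\<exists>M. martingale_modification T (P s x) s x \<phi> \<psi> M))"

definition ext_domain ::
  "real \<Rightarrow> (real \<Rightarrow> 'e::polish_space \<Rightarrow> (real \<Rightarrow> 'e) measure)
     \<Rightarrow> (real \<times> 'e \<Rightarrow> real) set" where
  "ext_domain T P = {\<phi>. \<exists>\<psi>. ext_generator T P \<phi> \<psi>}"

definition ext_martingale ::
  "real \<Rightarrow> (real \<Rightarrow> 'e::polish_space \<Rightarrow> (real \<Rightarrow> 'e) measure)
     \<Rightarrow> (real \<times> 'e \<Rightarrow> real) \<Rightarrow> real \<Rightarrow> 'e
     \<Rightarrow> (real \<Rightarrow> (real \<Rightarrow> 'e) \<Rightarrow> real) \<Rightarrow> bool" where
  "ext_martingale T P \<phi> s x M \<longleftrightarrow>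
     (\<exists>\<psi>. ext_generator T P \<phi> \<psi> \<and> martingale_modification T (P s x) s x \<phi> \<psi> M)"

definition ext_carre_du_champ ::
  "real \<Rightarrow> (real \<Rightarrow> 'e::polish_space \<Rightarrow> (real \<Rightarrow> 'e) measure)
     \<Rightarrow> (real \<times> 'e \<Rightarrow> real) \<Rightarrow> (real \<times> 'e \<Rightarrow> real) \<Rightarrow> bool" where
  "ext_carre_du_champ T P \<phi> G \<longleftrightarrow>
     \<phi> \<in> ext_domain T P \<and> G \<in> borel_fun T \<and> (\<forall>z. 0 \<le> G z) \<and>
     (\<forall>s\<in>{0..T}. \<forall>x. \<forall>M. ext_martingale T P \<phi> s x M \<longrightarrow>
        (\<exists>A. angle_bracket T (P s x) M A \<and>
             (AE \<omega> in completion (P s x).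
                path_integrable G s T \<omega> \<and>
                (\<forall>t\<in>{s..T}. A t \<omega> = path_integral G s t \<omega>))))"


section \<open>Martingale solutions and decoupled mild solutions\<close>

text \<open>By uniqueness of the extended operators up to zero potential sets, the choice of the
  versions \<open>\<psi>\<close> and \<open>G\<close> is immaterial.\<close>

definition martingale_solution ::
  "real \<Rightarrow> (real \<Rightarrow> 'e::polish_space \<Rightarrow> (real \<Rightarrow> 'e) measure)
     \<Rightarrow> (real \<times> 'e \<times> real \<times> real \<Rightarrow> real) \<Rightarrow> ('e \<Rightarrow> real)
     \<Rightarrow> (real \<times> 'e \<Rightarrow> real) \<Rightarrow> bool" where
  "martingale_solution T P f g u \<longleftrightarrow>
     u \<in> ext_domain T P \<and>
     (\<exists>\<psi> G. ext_generator T P u \<psi> \<and> ext_carre_du_champ T P u G \<and>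
        zero_potential T P
          {(t, x). t \<in> {0..T} \<and> \<psi> (t, x) \<noteq> - f (t, x, u (t, x), sqrt (G (t, x)))}) \<and>
     (\<forall>x. u (T, x) = g x)"

definition trans_op ::
  "(real \<Rightarrow> 'e \<Rightarrow> (real \<Rightarrow> 'e) measure) \<Rightarrow> real \<Rightarrow> real \<Rightarrow> ('e \<Rightarrow> real) \<Rightarrow> 'e \<Rightarrow> real" where
  "trans_op P s t h x = (LINT \<omega>|P s x. h (\<omega> t))"

definition trans_op_defined ::
  "(real \<Rightarrow> 'e \<Rightarrow> (real \<Rightarrow> 'e) measure) \<Rightarrow> real \<Rightarrow> real \<Rightarrow> ('e \<Rightarrow> real) \<Rightarrow> 'e \<Rightarrow> bool" where
  "trans_op_defined P s t h x \<longleftrightarrow> integrable (P s x) (\<lambda>\<omega>. h (\<omega> t))"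

text \<open>The expression \<open>\<integral>\<^sub>s\<^sup>T P\<^bsub>s,r\<^esub>[h(r,\<cdot>)](x) dr\<close> is meaningful.\<close>

definition trans_op_integrable ::
  "(real \<Rightarrow> 'e \<Rightarrow> (real \<Rightarrow> 'e) measure) \<Rightarrow> real \<Rightarrow> real \<Rightarrow> (real \<Rightarrow> 'e \<Rightarrow> real) \<Rightarrow> 'e \<Rightarrow> bool" where
  "trans_op_integrable P s T h x \<longleftrightarrow>
     (AE r in lborel. r \<in> {s..T} \<longrightarrow> trans_op_defined P s r (h r) x) \<and>
     set_integrable lborel {s..T} (\<lambda>r. trans_op P s r (h r) x)"

definition IP_solution ::
  "real \<Rightarrow> (real \<Rightarrow> 'e::polish_space \<Rightarrow> (real \<Rightarrow> 'e) measure)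
     \<Rightarrow> (real \<times> 'e \<times> real \<times> real \<Rightarrow> real) \<Rightarrow> ('e \<Rightarrow> real)
     \<Rightarrow> (real \<times> 'e \<Rightarrow> real) \<Rightarrow> (real \<times> 'e \<Rightarrow> real) \<Rightarrow> bool" where
  "IP_solution T P f g u v \<longleftrightarrow>
     u \<in> LpX T P 2 \<and> v \<in> LpX T P 2 \<and> (\<forall>z. 0 \<le> v z) \<and>
     (\<forall>s\<in>{0..T}. \<forall>x.
        (let F = (\<lambda>r y. f (r, y, u (r, y), v (r, y)));
             H = (\<lambda>r y. (v (r, y))\<^sup>2 - 2 * u (r, y) * f (r, y, u (r, y), v (r, y)))
         in trans_op_defined P s T g x \<and>
            trans_op_defined P s T (\<lambda>y. (g y)\<^sup>2) x \<and>
            trans_op_integrable P s T F x \<and>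
            trans_op_integrable P s T H x \<and>
            u (s, x) = trans_op P s T g x + (LINT r:{s..T}|lborel. trans_op P s r (F r) x) \<and>
            (u (s, x))\<^sup>2 =
              trans_op P s T (\<lambda>y. (g y)\<^sup>2) x - (LINT r:{s..T}|lborel. trans_op P s r (H r) x)))"

definition decoupled_mild_solution ::
  "real \<Rightarrow> (real \<Rightarrow> 'e::polish_space \<Rightarrow> (real \<Rightarrow> 'e) measure)
     \<Rightarrow> (real \<times> 'e \<times> real \<times> real \<Rightarrow> real) \<Rightarrow> ('e \<Rightarrow> real)
     \<Rightarrow> (real \<times> 'e \<Rightarrow> real) \<Rightarrow> bool" where
  "decoupled_mild_solution T P f g u \<longleftrightarrow> (\<exists>v. IP_solution T P f g u v)"

end

(* Let M be the martingale part of u(t, X_t), so that u(t, X_t) = u(s, x) + M_t + V_t with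
   V_t the time integral of \<psi>(r, X_r). Taking expectations at time T gives the first equation.
   For the second, no stochastic integration is needed: the martingale property gives
   E[\<psi>(r, X_r) (M_T - M_r)] = 0 for almost every r, and integrating over r, together with
   V_T^2 = 2 * (integral of \<psi>(r, X_r) V_r) and E[M_T^2] = E[\<langle>M\<rangle>_T], yields the energy identity.

   The equation is satisfied with one version of the carre du champ and has to be
   transferred to any other. The brackets of two versions are absolutely continuous, so their
   densities have the same integral against left-endpoint discretizations of k(r, X_r), for every
   bounded continuous k. These converge to k(r, X_r) for almost every r because a cadlag path has
   countably many jumps, and bounded continuous functions determine a finite measure. *)

theory Submission
  imports Defs
begin

section \<open>Lebesgue measure on an interval\<close>

text \<open>The energy identity multiplies \<psi>(r, X_r) by other processes, yet no second moment
  of \<psi> is given. It comes from the growth bound: the time integral of the carre du champ G has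
  expectation E[M_T^2], finite because M lies in \<open>H2_0\<close>, so sqrt G is square integrable
  over law and time, hence so are f(r, X_r, u, sqrt G) and \<psi>.

  Fubini needs processes jointly measurable in time and path, whereas M is described at fixed times
  and on the completed space. The process u(r, X_r) - u(s, x) - V_r, jointly measurable by
  construction, stands in for M under Fubini; the martingale property is applied to M at fixed
  times.

  Two versions of the carre du champ can be compared because a bracket increment over (t, w], tested
  against a bounded B known at time t, has expectation E[B (M_w^2 - M_t^2)], which mentions M alone.
  Both versions being functions of (r, X_r), it suffices to compare them under the image of law
  times Lebesgue measure on space-time, a metric space.\<close>

definition interval_measure :: "real \<Rightarrow> real \<Rightarrow> real measure" where
  "interval_measure s t = density lborel (indicator {s..t})"

lemma sets_interval_measure [measurable_cong, simp]: "sets (interval_measure s t) = sets borel"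
  and space_interval_measure [simp]: "space (interval_measure s t) = UNIV"
  by (simp_all add: interval_measure_def)

text \<open>The density rules for Bochner integrals expect a real density embedded by
  \<open>ennreal\<close>.\<close>

lemma interval_measure_real: "interval_measure s t = density lborel (\<lambda>r. ennreal (indicator {s..t} r))"
  by (simp add: interval_measure_def ennreal_indicator)

lemma emeasure_interval_measure_UNIV: "emeasure (interval_measure s t) UNIV = ennreal (t - s)" if "s \<le> t"
  using that by (simp add: interval_measure_def emeasure_density)

lemma finite_measure_interval_measure: "finite_measure (interval_measure s t)"
  by (cases "s \<le> t") (auto intro!: finite_measureI simp: interval_measure_def emeasure_density)

lemma AE_interval_measure:
  "(AE r in interval_measure s t. R r) \<longleftrightarrow> (AE r in lborel. r \<in> {s..t} \<longrightarrow> R r)"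
  unfolding interval_measure_def
  by (subst AE_density) (auto simp: indicator_def intro!: AE_cong)

lemma AE_interval_measure_in: "AE r in interval_measure s t. r \<in> {s..t}"
  by (simp add: AE_interval_measure)

lemma AE_interval_measure_countable: "countable A \<Longrightarrow> AE r in interval_measure s t. r \<notin> A"
  unfolding AE_interval_measure
  using AE_not_in[OF countable_imp_null_set_lborel, of A] by (auto elim: eventually_mono)

lemma AE_interval_measure_neq: "AE r in interval_measure s t. r \<noteq> c"
  using AE_interval_measure_countable[of "{c}" s t] by simp

lemma nn_integral_interval_measure:
  "h \<in> borel_measurable borel \<Longrightarrow>
     (\<integral>\<^sup>+ r. h r \<partial>interval_measure s t) = (\<integral>\<^sup>+ r\<in>{s..t}. h r \<partial>lborel)"
  unfolding interval_measure_def by (subst nn_integral_density) (auto simp: mult.commute)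

lemma set_integrable_interval_measure:
  fixes h :: "real \<Rightarrow> real"
  shows "h \<in> borel_measurable borel \<Longrightarrow>
     set_integrable lborel {s..t} h \<longleftrightarrow> integrable (interval_measure s t) h"
  unfolding interval_measure_real set_integrable_def by (subst integrable_density) auto

lemma set_integral_interval_measure:
  fixes h :: "real \<Rightarrow> real"
  shows "h \<in> borel_measurable borel \<Longrightarrow>
     (LINT r:{s..t}|lborel. h r) = (LINT r|interval_measure s t. h r)"
  unfolding interval_measure_real set_lebesgue_integral_def by (subst integral_density) auto

lemma set_integral_interval_measure_subset:
  fixes h :: "real \<Rightarrow> real"
  assumes "h \<in> borel_measurable borel" "r \<in> {s..t}"
  shows "(LINT q:{s..r}|lborel. h q) = (LINT q|interval_measure s t. indicator {..r} q * h q)"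
proof -
  have "(LINT q|interval_measure s t. indicator {..r} q * h q) = (LINT q:{s..t}|lborel. indicator {..r} q * h q)"
    using assms by (intro set_integral_interval_measure[symmetric]) auto
  also have "\<dots> = (LINT q:{s..r}|lborel. h q)"
    using assms unfolding set_lebesgue_integral_def
    by (intro Bochner_Integration.integral_cong) (auto simp: indicator_def)
  finally show ?thesis ..
qed

text \<open>One starting time and one law; at the end \<open>Q\<close> becomes \<open>P s x\<close>.
  Martingales live on \<open>completion Q\<close>, Fubini is applied to
  \<open>Q \<Otimes>\<^sub>M L\<close>, and integrals are carried between \<open>Q\<close> and its
  completion.\<close>

locale canonical_start =
  fixes T s :: real and Q :: "(real \<Rightarrow> 'e::polish_space) measure"
  assumes s_nonneg: "0 \<le> s" and s_le_T: "s \<le> T" and canonical: "canonical_prob T Q"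
begin

sublocale prob_space Q
  using canonical by (simp add: canonical_prob_def)

sublocale K: prob_space "completion Q"
  by (rule prob_space_completion)

abbreviation L :: "real measure" where "L \<equiv> interval_measure s T"

sublocale L: finite_measure L
  by (rule finite_measure_interval_measure)

sublocale QL: pair_sigma_finite Q L ..

sublocale QL_finite: finite_measure "Q \<Otimes>\<^sub>M L"
  by (rule finite_measure_pair_measure) unfold_locales

end

section \<open>Measurability on the path space\<close>

lemma space_coord_algebra [simp]: "space (coord_algebra T I) = paths T"
  unfolding coord_algebra_def by (rule space_measure_of) auto

lemma sets_coord_algebra:
  "sets (coord_algebra T I :: (real \<Rightarrow> 'e::polish_space) measure) =
     sigma_sets (paths T) {{\<omega> \<in> paths T. \<omega> r \<in> A} | r A. r \<in> I \<and> A \<in> sets borel}"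
  unfolding coord_algebra_def by (rule sets_measure_of) auto

lemma measurable_coord: "r \<in> I \<Longrightarrow> (\<lambda>\<omega>. \<omega> r) \<in> measurable (coord_algebra T I) (borel :: 'a::polish_space measure)"
proof (rule measurableI)
  fix A :: "'a set" assume "r \<in> I" "A \<in> sets borel"
  then show "(\<lambda>\<omega>. \<omega> r) -` A \<inter> space (coord_algebra T I) \<in> sets (coord_algebra T I)"
    unfolding sets_coord_algebra space_coord_algebra by (intro sigma_sets.Basic) auto
qed auto

lemma space_canonical_algebra [simp]: "space (canonical_algebra T) = paths T"
  by (simp add: canonical_algebra_def)

text \<open>For \<open>t < T\<close> the index \<open>T\<close> itself occurs in the intersection;
  over an empty index set the intersection would be \<open>UNIV\<close>.\<close>

lemma coord_sets_subset_Pow: "(\<Inter>q\<in>{t<..T}. sets (coord_algebra T {0..q})) \<subseteq> Pow (paths T :: (real \<Rightarrow> 'e::polish_space) set)" if "t < T"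
proof -
  have "sets (coord_algebra T {0..T}) \<subseteq> Pow (paths T :: (real \<Rightarrow> 'e) set)"
    using sets.space_closed[of "coord_algebra T {0..T}"] by simp
  with that show ?thesis by (intro order_trans[OF INT_lower[of T]]) auto
qed

lemma sets_canonical_filtration:
  assumes "t < T"
  shows "sets (canonical_filtration T t :: (real \<Rightarrow> 'e::polish_space) measure) =
    sigma_sets (paths T) (\<Inter>q\<in>{t<..T}. sets (coord_algebra T {0..q}))"
  using assms sets_measure_of[OF coord_sets_subset_Pow[OF assms]]
  unfolding canonical_filtration_def by simp

lemma sets_canonical_filtration_le:
  "sets (canonical_filtration T t) \<subseteq> sets (canonical_algebra T :: (real \<Rightarrow> 'e::polish_space) measure)"
proof (cases "t < T")
  case True
  have "(\<Inter>q\<in>{t<..T}. sets (coord_algebra T {0..q})) \<subseteq> sets (canonical_algebra T :: (real \<Rightarrow> 'e) measure)"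
    using True by (auto simp: canonical_algebra_def)
  from sets.sigma_sets_subset[OF this] show ?thesis
    by (simp add: sets_canonical_filtration[OF True])
qed (simp add: canonical_filtration_def)

lemma coord_set_in_canonical_filtration:
  fixes A :: "'e::polish_space set"
  assumes "t \<in> {0..T}" "A \<in> sets borel"
  shows "{\<omega> \<in> paths T. \<omega> t \<in> A} \<in> sets (canonical_filtration T t)"
proof (cases "t < T")
  case True
  have "{\<omega> \<in> paths T. \<omega> t \<in> A} \<in> sets (coord_algebra T {0..q})" if "t < q" "q \<le> T" for q
    unfolding sets_coord_algebra using assms that by (intro sigma_sets.Basic CollectI exI[of _ t]) auto
  then show ?thesis
    using True by (auto simp: sets_canonical_filtration[OF True] intro!: sigma_sets.Basic)
next
  case False
  with assms show ?thesis
    unfolding canonical_filtration_def canonical_algebra_def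
    by (auto simp: sets_coord_algebra intro!: sigma_sets.Basic)
qed

text \<open>Right-continuity makes evaluation the pointwise limit of evaluations at rational times
  approaching from the right.\<close>

lemma measurable_eval_pair:
  "(\<lambda>(\<omega>, r). \<omega> r) \<in> measurable (canonical_algebra T \<Otimes>\<^sub>M borel) (borel :: 'e::polish_space measure)"
proof -
  \<comment> \<open>The smallest multiple of \<open>1 / Suc n\<close> strictly greater than
    \<open>r\<close>, clamped to \<open>[0,T]\<close>. The \<open>+ 1\<close> after the floor keeps
    it strict when \<open>r\<close> is itself a multiple; at \<open>r = T\<close> the clamp returns
    \<open>T\<close>, where the path has no right-hand neighbours.\<close>
  define d where "d n r = min T (max 0 (real_of_int (\<lfloor>r * real (Suc n)\<rfloor> + 1) / real (Suc n)))" for n r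
  let ?N = "restrict_space (canonical_algebra T \<Otimes>\<^sub>M borel) (paths T \<times> {0..T}) :: ((real \<Rightarrow> 'e) \<times> real) measure"
  have sets_T: "paths T \<times> {0..T} \<in> sets (canonical_algebra T \<Otimes>\<^sub>M borel :: ((real \<Rightarrow> 'e) \<times> real) measure)"
    by (metis space_canonical_algebra sets.top pair_measureI atLeastAtMost_borel)
  have step: "(\<lambda>z. fst z (d n (snd z))) \<in> measurable ?N borel" for n
  proof -
    have ev: "(\<lambda>z. fst z (min T (max 0 (real_of_int (i + 1) / real (Suc n))))) \<in> measurable ?N borel" for i :: int
    proof (cases "0 \<le> T")
      case True
      have "(\<lambda>\<omega>. \<omega> (min T (max 0 (real_of_int (i + 1) / real (Suc n))))) \<in> measurable (canonical_algebra T) (borel :: 'e measure)"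
        unfolding canonical_algebra_def using True by (intro measurable_coord) auto
      from measurable_compose[OF measurable_fst this] show ?thesis
        by (rule measurable_restrict_space1)
    next
      case False
      then show ?thesis by (simp add: measurable_def space_restrict_space)
    qed
    have "(\<lambda>z. \<lfloor>snd z * real (Suc n)\<rfloor>) \<in> measurable ?N (count_space UNIV)"
      by (intro measurable_restrict_space1) measurable
    \<comment> \<open>The integer index takes countably many values, and for each of them the path
      is evaluated at a constant time.\<close>
    from measurable_compose_countable'[OF ev this]
    show ?thesis unfolding d_def by simp
  qed
  have lim: "(\<lambda>n. fst z (d n (snd z))) \<longlonglongrightarrow> fst z (snd z)" if "z \<in> space ?N" for z
  proof -
    obtain \<omega> r where z: "z = (\<omega>, r)" by (cases z)
    from that have \<omega>: "\<omega> \<in> paths T" and r: "r \<in> {0..T}"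
      by (auto simp: z space_restrict_space)
    show ?thesis
    proof (cases "r = T")
      case True
      have "d n r = r" for n
      proof -
        have "r * real (Suc n) \<le> real_of_int (\<lfloor>r * real (Suc n)\<rfloor> + 1)" by linarith
        then have "r \<le> real_of_int (\<lfloor>r * real (Suc n)\<rfloor> + 1) / real (Suc n)"
          by (simp add: pos_le_divide_eq)
        then show ?thesis using True by (auto simp: d_def)
      qed
      then show ?thesis by (simp add: z)
    next
      case False
      with r have r: "0 \<le> r" "r < T" by auto
      have gt: "d n r > r" for n
      proof -
        have "r * real (Suc n) < real_of_int (\<lfloor>r * real (Suc n)\<rfloor> + 1)" by linarith
        then have "r < real_of_int (\<lfloor>r * real (Suc n)\<rfloor> + 1) / real (Suc n)"
          by (simp add: pos_less_divide_eq)
        then show ?thesis using r by (auto simp: d_def)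
      qed
      have le: "d n r \<le> r + 1 / real (Suc n)" for n
      proof -
        have "real_of_int (\<lfloor>r * real (Suc n)\<rfloor> + 1) \<le> r * real (Suc n) + 1" by linarith
        then have "real_of_int (\<lfloor>r * real (Suc n)\<rfloor> + 1) / real (Suc n) \<le> (r * real (Suc n) + 1) / real (Suc n)"
          by (rule divide_right_mono) simp
        also have "\<dots> = r + 1 / real (Suc n)" by (simp add: field_simps del: of_nat_Suc)
        finally show ?thesis using r by (auto simp: d_def)
      qed
      have "(\<lambda>n. d n r) \<longlonglongrightarrow> r"
      proof (rule tendsto_sandwich[OF always_eventually always_eventually tendsto_const])
        show "(\<lambda>n. r + 1 / real (Suc n)) \<longlonglongrightarrow> r"
          using tendsto_add[OF tendsto_const LIMSEQ_inverse_real_of_nat, of r]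
          by (simp add: inverse_eq_divide)
      qed (use le gt in \<open>auto intro: less_imp_le\<close>)
      moreover have "d n r \<noteq> r" for n
        using gt[of n] by simp
      ultimately have "filterlim (\<lambda>n. d n r) (at_right r) sequentially"
        using gt by (auto simp: filterlim_at intro!: always_eventually)
      moreover have "(\<omega> \<longlongrightarrow> \<omega> r) (at_right r)"
        using \<omega> r by (auto simp: paths_def cadlag_on_def)
      ultimately show ?thesis
        by (auto simp: z intro: filterlim_compose)
    qed
  qed
  have N: "(\<lambda>z. fst z (snd z)) \<in> measurable ?N (borel :: 'e measure)"
    by (rule borel_measurable_LIMSEQ_metric[OF step lim])
  have set: "{z \<in> space (canonical_algebra T \<Otimes>\<^sub>M borel). z \<in> paths T \<times> {0..T}} \<in>
      sets (canonical_algebra T \<Otimes>\<^sub>M borel :: ((real \<Rightarrow> 'e) \<times> real) measure)"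
    using sets_T by (rule back_subst[where P="\<lambda>A. A \<in> _"]) (auto simp: space_pair_measure)
  \<comment> \<open>Off \<open>[0,T]\<close> every path takes the constant value
    \<open>undefined\<close>, which extends measurability to all real times.\<close>
  have "(\<lambda>z. if z \<in> paths T \<times> {0..T} then fst z (snd z) else undefined) \<in>
      measurable (canonical_algebra T \<Otimes>\<^sub>M borel) (borel :: 'e measure)"
    using N unfolding measurable_If_restrict_space_iff[OF set] Collect_mem_eq
    by (intro conjI) (assumption, rule measurable_const, simp)
  then show ?thesis
    by (rule measurable_cong[THEN iffD1, rotated])
       (auto simp: space_pair_measure paths_def extensional_def)
qed

text \<open>As a constant of its own, evaluation at (r, X_r) can carry the rule
  \<open>measurable_along\<close>, in which path and time may both vary.\<close>

definition along :: "(real \<times> 'e \<Rightarrow> real) \<Rightarrow> (real \<Rightarrow> 'e) \<Rightarrow> real \<Rightarrow> real" where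
  "along \<phi> \<omega> r = \<phi> (r, \<omega> r)"

section \<open>Square-integrable processes and martingales\<close>

lemma integrable_mult_of_squares:
  fixes f g :: "'a \<Rightarrow> real"
  assumes [measurable]: "f \<in> borel_measurable M" "g \<in> borel_measurable M"
    and sq: "integrable M (\<lambda>x. (f x)\<^sup>2)" "integrable M (\<lambda>x. (g x)\<^sup>2)"
  shows "integrable M (\<lambda>x. f x * g x)"
proof (rule Bochner_Integration.integrable_bound[OF Bochner_Integration.integrable_add[OF sq]])
  have "\<bar>f x * g x\<bar> \<le> (f x)\<^sup>2 + (g x)\<^sup>2" for x
  proof -
    have "0 \<le> \<bar>f x\<bar> * \<bar>g x\<bar>" by simp
    then show ?thesis
      using sum_squares_bound[of "\<bar>f x\<bar>" "\<bar>g x\<bar>"] unfolding abs_mult mult.assoc power2_abs by linarith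
  qed
  then show "AE x in M. norm (f x * g x) \<le> norm ((f x)\<^sup>2 + (g x)\<^sup>2)"
    by simp
qed simp

lemma integrable_add_squares:
  fixes f g :: "'a \<Rightarrow> real"
  assumes [measurable]: "f \<in> borel_measurable M" "g \<in> borel_measurable M"
    and sq: "integrable M (\<lambda>x. (f x)\<^sup>2)" "integrable M (\<lambda>x. (g x)\<^sup>2)"
  shows "integrable M (\<lambda>x. (f x + g x)\<^sup>2)"
  unfolding power2_sum
  using sq integrable_mult_of_squares[OF assms] by (simp add: mult.assoc)

text \<open>A factor known at time \<open>r\<close> passes through the conditional expectation given
  \<open>F r\<close>. Asking for integrability of the product, rather than boundedness of
  \<open>B\<close>, lets the same rule serve the constant 1, bounded test variables and the
  unbounded \<psi>(r, X_r).\<close>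

lemma martingale_integral_mult:
  assumes X: "martingale M F I X" and F: "finite_measure_subalgebra M (F r)"
    and rt: "r \<in> I" "t \<in> I" "r \<le> t"
    and [measurable]: "B \<in> borel_measurable (F r)"
    and int: "integrable M (\<lambda>\<omega>. B \<omega> * X t \<omega>)"
  shows "integrable M (\<lambda>\<omega>. B \<omega> * X r \<omega>)" (is ?I)
    and "(LINT \<omega>|M. B \<omega> * X t \<omega>) = (LINT \<omega>|M. B \<omega> * X r \<omega>)" (is ?E)
proof -
  interpret finite_measure_subalgebra M "F r" by (rule F)
  have [measurable]: "B \<in> borel_measurable M"
    by (rule measurable_from_subalg[OF subalg]) measurable
  have [measurable]: "X t \<in> borel_measurable M" "X r \<in> borel_measurable M"
    using X rt by (auto simp: martingale_def)
  have eq: "AE \<omega> in M. B \<omega> * real_cond_exp M (F r) (X t) \<omega> = B \<omega> * X r \<omega>"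
    using X rt by (auto simp: martingale_def elim!: eventually_mono)
  note * = real_cond_exp_intg[OF int, simplified]
  show ?I
    by (rule iffD1[OF integrable_cong_AE[OF _ _ eq] *(1)]) auto
  show ?E
    unfolding *(2)[symmetric] by (rule integral_cong_AE[OF _ _ eq]) auto
qed

section \<open>The completed stochastic basis and the finite variation part\<close>

context canonical_start
begin

lemma sets_Q: "sets Q = sets (canonical_algebra T)"
  using canonical by (simp add: canonical_prob_def)

lemma space_Q: "space Q = paths T"
  using sets_eq_imp_space_eq[OF sets_Q] by simp

lemma T_nonneg: "0 \<le> T"
  using s_nonneg s_le_T by simp

lemma measurable_eval: "(\<lambda>(\<omega>, r). \<omega> r) \<in> measurable (Q \<Otimes>\<^sub>M borel) borel"
  using measurable_eval_pair[of T] measurable_cong_sets[OF sets_pair_measure_cong[OF sets_Q refl] refl]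
  by blast

lemma measurable_along [measurable (raw)]:
  fixes \<phi> :: "real \<times> 'e \<Rightarrow> real"
  assumes "\<phi> \<in> borel_measurable borel" "f \<in> measurable N Q" "h \<in> borel_measurable N"
  shows "(\<lambda>z. along \<phi> (f z) (h z)) \<in> borel_measurable N"
proof -
  have "(\<lambda>z. (f z, h z)) \<in> measurable N (Q \<Otimes>\<^sub>M borel)"
    using assms by measurable
  from measurable_compose[OF this measurable_eval]
  have "(\<lambda>z. f z (h z)) \<in> measurable N borel" by simp
  then have "(\<lambda>z. (h z, f z (h z))) \<in> measurable N (borel :: (real \<times> 'e) measure)"
    using assms(3) by (simp add: borel_prod[symmetric])
  from measurable_compose[OF this assms(1)] show ?thesis
    by (simp add: along_def)
qed

lemma measurable_along_path: "\<phi> \<in> borel_measurable (borel :: (real \<times> 'e) measure) \<Longrightarrow> \<omega> \<in> paths T \<Longrightarrow> along \<phi> \<omega> \<in> borel_measurable borel"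
  using measurable_along[of \<phi> "\<lambda>_. \<omega>" borel "\<lambda>r. r"] by (simp add: space_Q)

lemma completed_filtration_le: "subalgebra (completion Q) (completed_filtration T Q t)"
proof -
  have le: "sets (canonical_filtration T t) \<union> null_sets (completion Q) \<subseteq> sets (completion Q)"
    using sets_canonical_filtration_le[of T t] by (auto simp: sets_Q[symmetric])
  show ?thesis
    using sets.sigma_sets_subset[OF le] order_trans[OF le sets.space_closed]
    by (simp add: subalgebra_def completed_filtration_def)
qed

lemma finite_measure_subalgebra_filtration:
  "finite_measure_subalgebra (completion Q) (completed_filtration T Q t)"
  using completed_filtration_le K.finite_measure_axioms
  by (simp add: finite_measure_subalgebra_def finite_measure_subalgebra_axioms_def)

text \<open>Makes k(t, X_t) and \<psi>(t, X_t) admissible as the factor \<open>B\<close> of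
  \<open>martingale_integral_mult\<close>.\<close>

lemma along_adapted:
  fixes \<phi> :: "real \<times> 'e \<Rightarrow> real"
  assumes "t \<in> {0..T}" "\<phi> \<in> borel_measurable borel"
  shows "(\<lambda>\<omega>. along \<phi> \<omega> t) \<in> borel_measurable (completed_filtration T Q t)"
proof -
  have sub: "sets (canonical_filtration T t) \<subseteq> sets (completed_filtration T Q t)"
  proof -
    have le: "sets (canonical_filtration T t) \<union> null_sets (completion Q) \<subseteq> sets (completion Q)"
      using sets_canonical_filtration_le[of T t] by (auto simp: sets_Q[symmetric])
    from order_trans[OF le sets.space_closed] show ?thesis
      by (auto simp: completed_filtration_def intro: sigma_sets.Basic)
  qed
  have [simp]: "space (completed_filtration T Q t) = paths T"
    using completed_filtration_le[of t] by (simp add: subalgebra_def space_Q)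
  have "(\<lambda>\<omega>. \<omega> t) \<in> measurable (completed_filtration T Q t) (borel :: 'e measure)"
  proof (rule measurableI)
    fix A :: "'e set" assume "A \<in> sets borel"
    from coord_set_in_canonical_filtration[OF assms(1) this] sub
    show "(\<lambda>\<omega>. \<omega> t) -` A \<inter> space (completed_filtration T Q t) \<in> sets (completed_filtration T Q t)"
      by (auto simp: vimage_def Int_def conj_commute)
  qed simp
  then have "(\<lambda>\<omega>. (t, \<omega> t)) \<in> measurable (completed_filtration T Q t) (borel :: (real \<times> 'e) measure)"
    by (simp add: borel_prod[symmetric])
  from measurable_compose[OF this assms(2)] show ?thesis
    by (simp add: along_def)
qed

lemma H2_0_measurable:
  "M \<in> H2_0 T Q \<Longrightarrow> t \<in> {0..T} \<Longrightarrow> M t \<in> borel_measurable (completion Q)"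
  by (auto simp: H2_0_def martingale_def)

lemma H2_0_square_integrable:
  assumes M: "M \<in> H2_0 T Q" and t: "t \<in> {0..T}"
  shows "integrable (completion Q) (\<lambda>\<omega>. (M t \<omega>)\<^sup>2)"
proof (rule integrableI_nonneg)
  have "(\<integral>\<^sup>+ \<omega>. ennreal ((M t \<omega>)\<^sup>2) \<partial>completion Q)
      \<le> (\<integral>\<^sup>+ \<omega>. (SUP t\<in>{0..T}. ennreal ((M t \<omega>)\<^sup>2)) \<partial>completion Q)"
    by (intro nn_integral_mono SUP_upper t)
  also have "\<dots> < \<infinity>" using M by (simp add: H2_0_def)
  finally show "(\<integral>\<^sup>+ \<omega>. ennreal ((M t \<omega>)\<^sup>2) \<partial>completion Q) < \<infinity>" .
qed (use H2_0_measurable[OF M t] in auto)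

text \<open>The process V of the overview. The upper limit sits in an indicator under the fixed
  measure \<open>L\<close>, so joint measurability in time and path follows from that of the
  integrand.\<close>

definition int_to :: "(real \<times> 'e \<Rightarrow> real) \<Rightarrow> real \<Rightarrow> (real \<Rightarrow> 'e) \<Rightarrow> real" where
  "int_to \<psi> r \<omega> = (LINT q|L. indicator {..r} q * along \<psi> \<omega> q)"

lemma path_integral_eq_int_to:
  fixes \<psi> :: "real \<times> 'e \<Rightarrow> real"
  shows "\<psi> \<in> borel_measurable borel \<Longrightarrow> \<omega> \<in> paths T \<Longrightarrow> r \<in> {s..T} \<Longrightarrow> path_integral \<psi> s r \<omega> = int_to \<psi> r \<omega>"
  unfolding path_integral_def int_to_def
  using set_integral_interval_measure_subset[OF measurable_along_path[of \<psi> \<omega>], of r s T]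
  by (simp add: along_def)

lemma path_integrable_iff:
  fixes \<psi> :: "real \<times> 'e \<Rightarrow> real"
  shows "\<psi> \<in> borel_measurable borel \<Longrightarrow> \<omega> \<in> paths T \<Longrightarrow> path_integrable \<psi> s T \<omega> \<longleftrightarrow> integrable L (along \<psi> \<omega>)"
  unfolding path_integrable_def
  using set_integrable_interval_measure[OF measurable_along_path[of \<psi> \<omega>], of s T]
  by (simp add: along_def[abs_def])

lemma measurable_int_to [measurable (raw)]:
  assumes [measurable]: "\<psi> \<in> borel_measurable borel" "f \<in> measurable N Q" "h \<in> borel_measurable N"
  shows "(\<lambda>z. int_to \<psi> (h z) (f z)) \<in> borel_measurable N"
proof -
  \<comment> \<open>The set \<open>{..r}\<close> moves with the point; written as the condition
    \<open>q \<le> r\<close>, it is visibly measurable in both variables together.\<close>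
  have ind: "indicator {..r} q = (if q \<le> r then 1 else 0 :: real)" for q r :: real
    by simp
  show ?thesis unfolding int_to_def ind by measurable
qed

lemma int_to_T: "int_to \<psi> T \<omega> = (LINT q|L. along \<psi> \<omega> q)" if "\<psi> \<in> borel_measurable borel" "\<omega> \<in> paths T"
proof -
  have [measurable]: "along \<psi> \<omega> \<in> borel_measurable borel" using that by (rule measurable_along_path)
  show ?thesis
    unfolding int_to_def
    by (intro integral_cong_AE) (auto intro!: eventually_mono[OF AE_interval_measure_in])
qed

end

section \<open>Uniqueness of the density of the angular bracket\<close>

text \<open>Choose for each such \<open>r\<close> a rational \<open>c r < r\<close> with
  \<open>q < a\<close> on the open interval from \<open>c r\<close> to \<open>r\<close>. If
  \<open>x < y\<close> shared this rational, \<open>x\<close> would lie in the interval of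
  \<open>y\<close>, giving \<open>q x < a\<close> against \<open>a < q x\<close>; so the choice is
  injective.\<close>

lemma countable_left_jumps_above:
  fixes q :: "real \<Rightarrow> real"
  shows "countable {r. a < q r \<and> (\<forall>\<^sub>F x in at_left r. q x < a)}" (is "countable ?J")
proof -
  have "\<exists>c\<in>\<rat>. c < r \<and> (\<forall>x. c < x \<longrightarrow> x < r \<longrightarrow> q x < a)" if "r \<in> ?J" for r
  proof -
    from that obtain b where b: "b < r" "\<And>x. b < x \<Longrightarrow> x < r \<Longrightarrow> q x < a"
      unfolding eventually_at_left_field by auto
    from Rats_dense_in_real[OF b(1)] obtain c where "c \<in> \<rat>" "b < c" "c < r" by auto
    with b show ?thesis by (intro bexI[of _ c]) auto
  qed
  then obtain c where c: "\<And>r. r \<in> ?J \<Longrightarrow> c r \<in> \<rat> \<and> c r < r \<and> (\<forall>x. c r < x \<longrightarrow> x < r \<longrightarrow> q x < a)"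
    by metis
  have "inj_on c ?J"
  proof (rule linorder_inj_onI)
    fix x y assume xy: "x < y" "x \<in> ?J" "y \<in> ?J"
    show "c x \<noteq> c y"
    proof
      assume "c x = c y"
      with c[OF xy(2)] have "c y < x" by simp
      with c[OF xy(3)] xy(1) have "q x < a" by blast
      with xy(2) show False by simp
    qed
  qed auto
  moreover have "countable (c ` ?J)"
    by (rule countable_subset[OF _ countable_rat]) (use c in auto)
  ultimately show ?thesis by (rule countable_image_inj_on[rotated])
qed

text \<open>Some rational level separates \<open>q r\<close> from a different left limit. For each
  of the countably many levels the upward jumps across it are countable, and downward jumps are
  upward jumps of \<open>- q\<close>.\<close>

lemma countable_left_discontinuities:
  fixes q :: "real \<Rightarrow> real"
  assumes "\<And>r. r \<in> S \<Longrightarrow> \<exists>l. (q \<longlongrightarrow> l) (at_left r)"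
  shows "countable {r \<in> S. \<not> (q \<longlongrightarrow> q r) (at_left r)}"
proof (rule countable_subset)
  define J where "J q a = {r. a < q r \<and> (\<forall>\<^sub>F x in at_left r. q x < a)}" for q :: "real \<Rightarrow> real" and a
  show "countable ((\<Union>a\<in>\<rat>. J q a) \<union> (\<Union>a\<in>\<rat>. J (\<lambda>x. - q x) a))"
    unfolding J_def by (intro countable_Un countable_UN countable_rat countable_left_jumps_above)
  show "{r \<in> S. \<not> (q \<longlongrightarrow> q r) (at_left r)} \<subseteq> (\<Union>a\<in>\<rat>. J q a) \<union> (\<Union>a\<in>\<rat>. J (\<lambda>x. - q x) a)"
  proof safe
    fix r assume r: "r \<in> S" "\<not> (q \<longlongrightarrow> q r) (at_left r)" "r \<notin> (\<Union>a\<in>\<rat>. J (\<lambda>x. - q x) a)"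
    obtain l where l: "(q \<longlongrightarrow> l) (at_left r)" using assms r(1) by blast
    with r(2) consider "l < q r" | "q r < l" by (metis linorder_neqE)
    then show "r \<in> (\<Union>a\<in>\<rat>. J q a)"
    proof cases
      case 1
      then obtain a where "a \<in> \<rat>" "l < a" "a < q r" using Rats_dense_in_real by metis
      then show ?thesis using order_tendstoD(2)[OF l, of a] by (auto simp: J_def)
    next
      case 2
      then obtain a where "a \<in> \<rat>" "- l < a" "a < - q r"
        using Rats_dense_in_real[of "- l" "- q r"] by auto
      then have "r \<in> (\<Union>a\<in>\<rat>. J (\<lambda>x. - q x) a)"
        using order_tendstoD(2)[OF tendsto_minus[OF l], of a] by (auto simp: J_def)
      with r(3) show ?thesis by blast
    qed
  qed
qed

text \<open>The cells are open on the left, so the coefficient used at \<open>r\<close> belongs to a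
  time strictly before \<open>r\<close>, as a left limit requires.\<close>

lemma grid_sum_indicator:
  fixes h r :: real and c :: "nat \<Rightarrow> real"
  assumes "0 < h" "s < r" "r \<le> s + real n * h"
  shows "\<exists>i<n. s + real i * h < r \<and> r \<le> s + real (Suc i) * h \<and>
    (\<Sum>j<n. indicator {s + real j * h<..s + real (Suc j) * h} r * c j) = c i"
proof -
  define x where "x = (r - s) / h"
  have x: "0 < x" "x \<le> real n"
    using assms by (auto simp: x_def pos_divide_le_eq)
  have iff: "r \<in> {s + real j * h<..s + real (Suc j) * h} \<longleftrightarrow> real j < x \<and> x \<le> real (Suc j)" for j
    using assms(1) by (auto simp: x_def pos_less_divide_eq pos_divide_le_eq simp del: of_nat_Suc)
  \<comment> \<open>The ceiling minus one, not the floor: a right endpoint belongs to the cell that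
    it closes.\<close>
  define i where "i = nat (\<lceil>x\<rceil> - 1)"
  have "int i = \<lceil>x\<rceil> - 1" using x by (simp add: i_def)
  then have "real i = real_of_int \<lceil>x\<rceil> - 1" by (metis of_int_diff of_int_1 of_int_of_nat_eq)
  then have i: "real i < x" "x \<le> real (Suc i)" by linarith+
  with x have "i < n" by linarith
  moreover have "(\<Sum>j<n. indicator {s + real j * h<..s + real (Suc j) * h} r * c j) = (\<Sum>j<n. if j = i then c j else 0)"
  proof (rule sum.cong)
    fix j
    have "real j < x \<and> x \<le> real (Suc j) \<longleftrightarrow> j = i" using i by auto
    then show "indicator {s + real j * h<..s + real (Suc j) * h} r * c j = (if j = i then c j else 0)"
      unfolding indicator_def iff by simp
  qed simp
  ultimately show ?thesis using i iff[of i] by (intro exI[of _ i]) auto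
qed

text \<open>For a nonempty closed set \<open>C\<close> the continuous functions
  \<open>max 0 (1 - n * infdist z C)\<close> tend to its indicator, so the two measures with
  densities \<open>G\<close> and \<open>G'\<close> agree on closed sets. These are stable under
  intersection and generate the Borel sets; both measures being finite, they coincide, and so do
  their densities almost everywhere.\<close>

lemma finite_measure_eqI_continuous_densities:
  fixes N :: "'a::metric_space measure" and G G' :: "'a \<Rightarrow> real"
  assumes sets_N [measurable_cong, simp]: "sets N = sets borel"
    and G: "integrable N G" "\<And>z. 0 \<le> G z" and G': "integrable N G'" "\<And>z. 0 \<le> G' z"
    and eq: "\<And>k. continuous_on UNIV k \<Longrightarrow> (\<And>z. 0 \<le> k z) \<Longrightarrow> (\<And>z. k z \<le> 1) \<Longrightarrow>
       (LINT z|N. k z * G z) = (LINT z|N. k z * G' z)"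
  shows "AE z in N. G z = G' z"
proof -
  have lim: "(\<lambda>n. LINT z|N. max 0 (1 - real n * infdist z C) * H z) \<longlonglongrightarrow> (LINT z|N. indicator C z * H z)"
    if "closed C" "C \<noteq> {}" and H: "integrable N H" "\<And>z. 0 \<le> H z" for C and H :: "'a \<Rightarrow> real"
  proof (rule integral_dominated_convergence[where w=H])
    have [measurable]: "H \<in> borel_measurable N" using H by auto
    have "(\<lambda>z. infdist z C) \<in> borel_measurable borel"
      by (intro borel_measurable_continuous_onI continuous_intros)
    then have [measurable]: "(\<lambda>z. infdist z C) \<in> borel_measurable N"
      using measurable_cong_sets[OF sets_N refl] by blast
    have [measurable]: "C \<in> sets N" using borel_closed[OF that(1)] by simp
    show "(\<lambda>z. max 0 (1 - real n * infdist z C) * H z) \<in> borel_measurable N" for n by measurable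
    show "(\<lambda>z. indicator C z * H z) \<in> borel_measurable N" by measurable
    show "AE z in N. norm (max 0 (1 - real n * infdist z C) * H z) \<le> H z" for n
    proof (rule AE_I2)
      fix z
      have "max 0 (1 - real n * infdist z C) \<le> 1" using infdist_nonneg[of z C] by simp
      then have "max 0 (1 - real n * infdist z C) * H z \<le> 1 * H z" using H by (intro mult_right_mono)
      moreover have "0 \<le> max 0 (1 - real n * infdist z C) * H z" using H by simp
      ultimately show "norm (max 0 (1 - real n * infdist z C) * H z) \<le> H z" by simp
    qed
    show "AE z in N. (\<lambda>n. max 0 (1 - real n * infdist z C) * H z) \<longlonglongrightarrow> indicator C z * H z"
    proof (rule AE_I2)
      fix z
      have "(\<lambda>n. max 0 (1 - real n * infdist z C)) \<longlonglongrightarrow> indicator C z"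
      proof (cases "z \<in> C")
        case False
        with that have pos: "0 < infdist z C" by (simp add: infdist_pos_not_in_closed)
        obtain m :: nat where m: "1 / infdist z C < real m" using reals_Archimedean2 by blast
        have "max 0 (1 - real n * infdist z C) = 0" if "m \<le> n" for n
        proof -
          have "1 < real m * infdist z C" using m pos by (simp add: pos_divide_less_eq)
          also have "\<dots> \<le> real n * infdist z C" using that pos by (intro mult_right_mono) auto
          finally show ?thesis by simp
        qed
        then have "\<forall>\<^sub>F n in sequentially. max 0 (1 - real n * infdist z C) = indicator C z"
          using False by (auto simp: eventually_sequentially)
        then show ?thesis by (rule tendsto_eventually)
      qed simp
      then show "(\<lambda>n. max 0 (1 - real n * infdist z C) * H z) \<longlonglongrightarrow> indicator C z * H z"
        by (intro tendsto_intros)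
    qed
  qed (rule H)
  have closed_eq: "(LINT z|N. indicator C z * G z) = (LINT z|N. indicator C z * G' z)" if "closed C" for C
  \<comment> \<open>\<open>infdist z {}\<close> is 0, so for the empty set the approximating
    functions would be constantly 1.\<close>
  proof (cases "C = {}")
    case False
    have "(LINT z|N. max 0 (1 - real n * infdist z C) * G z) = (LINT z|N. max 0 (1 - real n * infdist z C) * G' z)" for n
      by (rule eq) (auto intro!: continuous_intros simp: infdist_nonneg)
    with lim[OF that False G] lim[OF that False G'] show ?thesis
      by (simp add: LIMSEQ_unique)
  qed simp
  have dens: "emeasure (density N (\<lambda>z. ennreal (H z))) C = ennreal (LINT z|N. indicator C z * H z)"
    if "closed C" "integrable N H" "\<And>z. 0 \<le> H z" for C and H :: "'a \<Rightarrow> real"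
  proof -
    have [measurable]: "H \<in> borel_measurable N" "C \<in> sets N"
      using that(2) borel_closed[OF that(1)] by auto
    have C: "C \<in> sets borel" by (rule borel_closed[OF that(1)])
    have "emeasure (density N (\<lambda>z. ennreal (H z))) C = (\<integral>\<^sup>+ z. ennreal (indicator C z * H z) \<partial>N)"
      by (subst emeasure_density) (auto intro!: nn_integral_cong simp: indicator_def C)
    also have "\<dots> = ennreal (LINT z|N. indicator C z * H z)"
      using that integrable_mult_indicator[of C N H]
      by (intro nn_integral_eq_integral) auto
    finally show ?thesis .
  qed
  have borel: "sets (borel :: 'a measure) = sigma_sets UNIV (Collect closed)"
    by (subst borel_eq_closed) simp
  have "density N (\<lambda>z. ennreal (G z)) = density N (\<lambda>z. ennreal (G' z))"
  proof (rule measure_eqI_generator_eq[where E="Collect closed" and \<Omega>=UNIV and A="\<lambda>_. UNIV"])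
    show "Int_stable (Collect (closed :: 'a set \<Rightarrow> bool))" by (auto simp: Int_stable_def)
    show "emeasure (density N (\<lambda>z. ennreal (G z))) C = emeasure (density N (\<lambda>z. ennreal (G' z))) C"
      if "C \<in> Collect closed" for C
      using that dens[of C, OF _ G] dens[of C, OF _ G'] closed_eq[of C] by simp
    show "emeasure (density N (\<lambda>z. ennreal (G z))) UNIV \<noteq> \<infinity>"
      using dens[of UNIV, OF _ G] by simp
  qed (auto simp: borel)
  then have "AE z in N. ennreal (G z) = ennreal (G' z)"
    using G G' by (subst (asm) finite_density_unique)
      (auto simp: nn_integral_eq_integral[OF G(1)] nn_integral_eq_integral[OF G'(1)])
  then show ?thesis
    by eventually_elim (simp add: G G')
qed

section \<open>Testing brackets against left-endpoint step processes\<close>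

context canonical_start
begin

text \<open>What \<open>ext_carre_du_champ\<close> provides under a single law and for a fixed
  \<open>M\<close>: two versions of the carre du champ become two densities for the same
  martingale.\<close>

definition bracket_density :: "(real \<Rightarrow> (real \<Rightarrow> 'e) \<Rightarrow> real) \<Rightarrow> (real \<times> 'e \<Rightarrow> real) \<Rightarrow> bool" where
  "bracket_density M G \<longleftrightarrow>
     M \<in> H2_0 T Q \<and> G \<in> borel_measurable borel \<and> (\<forall>z. 0 \<le> G z) \<and>
     (\<exists>A. angle_bracket T Q M A \<and>
        (AE \<omega> in completion Q. path_integrable G s T \<omega> \<and> (\<forall>t\<in>{s..T}. A t \<omega> = path_integral G s t \<omega>)))"

text \<open>On \<open>[s,T]\<close> the bracket is the time integral of \<open>G\<close>, and the
  square of \<open>M\<close> minus the bracket is a martingale; a factor \<open>B\<close> known at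
  time \<open>t\<close> therefore sees the same increments of both. The right-hand sides do not
  mention \<open>G\<close>. Measurability of \<open>B\<close> is asked twice: for the filtration
  because of conditioning, for \<open>Q\<close> because of Fubini.\<close>

lemma bracket_density_increments:
  assumes "bracket_density M G"
  shows "integrable (Q \<Otimes>\<^sub>M L) (\<lambda>z. along G (fst z) (snd z))" (is ?I)
    and "(LINT z|(Q \<Otimes>\<^sub>M L). along G (fst z) (snd z)) = (LINT \<omega>|completion Q. (M T \<omega>)\<^sup>2)" (is ?E)
    and "\<And>t w B. s \<le> t \<Longrightarrow> t \<le> w \<Longrightarrow> w \<le> T \<Longrightarrow> B \<in> borel_measurable (completed_filtration T Q t) \<Longrightarrow>
       B \<in> borel_measurable Q \<Longrightarrow> (\<And>\<omega>. \<bar>B \<omega>\<bar> \<le> 1) \<Longrightarrow>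
       (LINT z|(Q \<Otimes>\<^sub>M L). B (fst z) * indicator {t<..w} (snd z) * along G (fst z) (snd z)) =
       (LINT \<omega>|completion Q. B \<omega> * ((M w \<omega>)\<^sup>2 - (M t \<omega>)\<^sup>2))"
proof -
  from assms obtain A where M: "M \<in> H2_0 T Q" and Gm [measurable]: "G \<in> borel_measurable borel"
    and G0: "\<And>z. 0 \<le> G z" and A: "angle_bracket T Q M A"
    and AG: "AE \<omega> in completion Q. path_integrable G s T \<omega> \<and> (\<forall>t\<in>{s..T}. A t \<omega> = path_integral G s t \<omega>)"
    by (auto simp: bracket_density_def)
  have mart: "martingale (completion Q) (completed_filtration T Q) {0..T} (\<lambda>t \<omega>. (M t \<omega>)\<^sup>2 - A t \<omega>)"
    using A by (simp add: angle_bracket_def)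
  have M2: "integrable (completion Q) (\<lambda>\<omega>. (M t \<omega>)\<^sup>2)" if "t \<in> {0..T}" for t
    by (rule H2_0_square_integrable[OF M that])
  have Ai: "integrable (completion Q) (A t)" if "t \<in> {0..T}" for t
  proof -
    have "integrable (completion Q) (\<lambda>\<omega>. (M t \<omega>)\<^sup>2 - ((M t \<omega>)\<^sup>2 - A t \<omega>))"
      by (rule Bochner_Integration.integrable_diff[OF M2[OF that]]) (use mart that in \<open>auto simp: martingale_def\<close>)
    then show ?thesis by simp
  qed
  have path: "AE \<omega> in completion Q. \<omega> \<in> paths T"
    using AE_space[of "completion Q"] by (simp add: space_Q)
  have AV: "AE \<omega> in completion Q. integrable L (along G \<omega>) \<and> (\<forall>t\<in>{s..T}. A t \<omega> = int_to G t \<omega>)"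
    using AG path by eventually_elim (auto simp: path_integrable_iff path_integral_eq_int_to)
  then have int_ae: "AE \<omega> in Q. integrable L (along G \<omega>)"
    unfolding AE_completion_iff by eventually_elim simp
  have T: "T \<in> {0..T}" "0 \<in> {0..T}" using T_nonneg by auto
  have eqT: "AE \<omega> in completion Q. A T \<omega> = (LINT r|L. along G \<omega> r)"
    using AV path by eventually_elim (use s_le_T in \<open>auto simp: int_to_T\<close>)
  have [measurable]: "(\<lambda>\<omega>. LINT r|L. along G \<omega> r) \<in> borel_measurable Q" by measurable
  have [measurable]: "A t \<in> borel_measurable (completion Q)" if "t \<in> {0..T}" for t
    using Ai[OF that] by simp
  have "integrable (completion Q) (\<lambda>\<omega>. LINT r|L. along G \<omega> r)"
    by (rule iffD1[OF integrable_cong_AE[OF _ _ eqT] Ai[OF T(1)]])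
       (use T in \<open>auto intro: measurable_completion\<close>)
  then have "integrable Q (\<lambda>\<omega>. LINT r|L. along G \<omega> r)"
    by (subst (asm) integrable_completion) auto
  then show I: ?I
    using int_ae
  proof (intro QL.Fubini_integrable)
    have [simp]: "\<bar>along G \<omega> r\<bar> = along G \<omega> r" for \<omega> r using G0 by (simp add: along_def)
    assume "integrable Q (\<lambda>\<omega>. LINT r|L. along G \<omega> r)"
    then show "integrable Q (\<lambda>\<omega>. LINT r|L. norm (along G (fst (\<omega>, r)) (snd (\<omega>, r))))" by simp
  qed simp_all
  have "(LINT z|(Q \<Otimes>\<^sub>M L). along G (fst z) (snd z)) = (LINT \<omega>|Q. LINT r|L. along G \<omega> r)"
    using QL.integral_fst[of "along G"] I by (simp add: case_prod_beta')
  also have "\<dots> = (LINT \<omega>|completion Q. LINT r|L. along G \<omega> r)"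
    by (rule integral_completion[symmetric]) measurable
  also have "\<dots> = (LINT \<omega>|completion Q. A T \<omega>)"
    by (rule integral_cong_AE) (use T eqT in \<open>auto intro: measurable_completion\<close>)
  also have "\<dots> = (LINT \<omega>|completion Q. (M T \<omega>)\<^sup>2)"
  proof -
    \<comment> \<open>The comparison goes back to time 0 and not to \<open>s\<close>: there
      \<open>H2_0\<close> and \<open>angle_bracket\<close> make both processes vanish.\<close>
    have "(LINT \<omega>|completion Q. 1 * ((M T \<omega>)\<^sup>2 - A T \<omega>)) = (LINT \<omega>|completion Q. 1 * ((M 0 \<omega>)\<^sup>2 - A 0 \<omega>))"
      using mart T T_nonneg M2 Ai
      by (intro martingale_integral_mult(2)[OF mart finite_measure_subalgebra_filtration]) auto
    also have "\<dots> = (LINT \<omega>|completion Q. 0)"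
    proof (rule integral_cong_AE)
      have "AE \<omega> in completion Q. M 0 \<omega> = 0" using M by (simp add: H2_0_def)
      moreover have "AE \<omega> in completion Q. A 0 \<omega> = 0" using A by (auto simp: angle_bracket_def elim: eventually_mono)
      ultimately show "AE \<omega> in completion Q. 1 * ((M 0 \<omega>)\<^sup>2 - A 0 \<omega>) = 0" by eventually_elim simp
    qed (use T H2_0_measurable[OF M] in auto)
    finally show ?thesis using M2[OF T(1)] Ai[OF T(1)] by simp
  qed
  finally show ?E .
  fix t w and B :: "(real \<Rightarrow> 'e) \<Rightarrow> real"
  assume tw: "s \<le> t" "t \<le> w" "w \<le> T" and BF [measurable]: "B \<in> borel_measurable (completed_filtration T Q t)"
    and [measurable]: "B \<in> borel_measurable Q" and B1: "\<And>\<omega>. \<bar>B \<omega>\<bar> \<le> 1"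
  have [measurable]: "B \<in> borel_measurable (completion Q)" by (rule measurable_completion) measurable
  have tw': "t \<in> {0..T}" "w \<in> {0..T}" using tw s_nonneg by auto
  have BX: "integrable (completion Q) (\<lambda>\<omega>. B \<omega> * X \<omega>)" if "integrable (completion Q) X" for X
  proof (rule Bochner_Integration.integrable_bound[OF that])
    show "AE \<omega> in completion Q. norm (B \<omega> * X \<omega>) \<le> norm (X \<omega>)"
      using B1 by (auto simp: abs_mult intro!: mult_left_le_one_le)
  qed (use that in auto)
  have ind: "indicator {t<..w} r * along G \<omega> r = indicator {..w} r * along G \<omega> r - indicator {..t} r * along G \<omega> r" for \<omega> r
    using tw by (auto simp: indicator_def)
  have inc: "AE \<omega> in completion Q. B \<omega> * (A w \<omega> - A t \<omega>) = (LINT r|L. B \<omega> * indicator {t<..w} r * along G \<omega> r)"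
    using AV path
  proof eventually_elim
    case (elim \<omega>)
    then have [measurable]: "along G \<omega> \<in> borel_measurable borel" by (simp add: measurable_along_path)
    have "integrable L (\<lambda>r. indicator {..v} r * along G \<omega> r)" for v
      using elim integrable_mult_indicator[of "{..v}" L "along G \<omega>"] by simp
    then have "A w \<omega> - A t \<omega> = (LINT r|L. indicator {t<..w} r * along G \<omega> r)"
      using elim tw by (simp add: ind int_to_def)
    then show ?case by (simp add: mult.assoc)
  qed
  have I2: "integrable (Q \<Otimes>\<^sub>M L) (\<lambda>z. B (fst z) * indicator {t<..w} (snd z) * along G (fst z) (snd z))"
  proof (rule Bochner_Integration.integrable_bound[OF I])
    have "\<bar>B \<omega> * indicator {t<..w} r * along G \<omega> r\<bar> \<le> \<bar>along G \<omega> r\<bar>" for \<omega> r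
      using B1[of \<omega>] by (auto simp: indicator_def abs_mult intro!: mult_left_le_one_le)
    then show "AE z in Q \<Otimes>\<^sub>M L. norm (B (fst z) * indicator {t<..w} (snd z) * along G (fst z) (snd z)) \<le> norm (along G (fst z) (snd z))"
      by simp
  qed measurable
  have "(LINT z|(Q \<Otimes>\<^sub>M L). B (fst z) * indicator {t<..w} (snd z) * along G (fst z) (snd z)) =
      (LINT \<omega>|Q. LINT r|L. B \<omega> * indicator {t<..w} r * along G \<omega> r)"
    using QL.integral_fst[of "\<lambda>\<omega> r. B \<omega> * indicator {t<..w} r * along G \<omega> r"] I2 by (simp add: case_prod_beta')
  also have "\<dots> = (LINT \<omega>|completion Q. LINT r|L. B \<omega> * indicator {t<..w} r * along G \<omega> r)"
    by (rule integral_completion[symmetric]) measurable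
  also have "\<dots> = (LINT \<omega>|completion Q. B \<omega> * (A w \<omega> - A t \<omega>))"
    by (rule integral_cong_AE) (use tw' inc in \<open>auto intro: measurable_completion\<close>)
  also have "\<dots> = (LINT \<omega>|completion Q. B \<omega> * ((M w \<omega>)\<^sup>2 - (M t \<omega>)\<^sup>2))"
  proof -
    have "(LINT \<omega>|completion Q. B \<omega> * ((M w \<omega>)\<^sup>2 - A w \<omega>)) = (LINT \<omega>|completion Q. B \<omega> * ((M t \<omega>)\<^sup>2 - A t \<omega>))"
      using tw tw' M2 Ai
      by (intro martingale_integral_mult(2)[OF mart finite_measure_subalgebra_filtration] BX) auto
    with BX[OF M2[OF tw'(1)]] BX[OF M2[OF tw'(2)]] BX[OF Ai[OF tw'(1)]] BX[OF Ai[OF tw'(2)]]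
    show ?thesis by (simp add: right_diff_distrib)
  qed
  finally show "(LINT z|(Q \<Otimes>\<^sub>M L). B (fst z) * indicator {t<..w} (snd z) * along G (fst z) (snd z)) =
       (LINT \<omega>|completion Q. B \<omega> * ((M w \<omega>)\<^sup>2 - (M t \<omega>)\<^sup>2))" .
qed

text \<open>Each coefficient is known at the start of its cell, as
  \<open>bracket_density_increments\<close> demands. Using \<open>Suc n\<close> cells avoids a
  division by zero.\<close>

definition grid_sum :: "(real \<times> 'e \<Rightarrow> real) \<Rightarrow> nat \<Rightarrow> (real \<Rightarrow> 'e) \<Rightarrow> real \<Rightarrow> real" where
  "grid_sum k n \<omega> r = (\<Sum>j<Suc n.
     indicator {s + real j * ((T - s) / real (Suc n))<..s + real (Suc j) * ((T - s) / real (Suc n))} r *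
       along k \<omega> (s + real j * ((T - s) / real (Suc n))))"

text \<open>Exactly one cell contains \<open>r\<close>, and \<open>t\<close> is its left endpoint.
  The time \<open>r = s\<close> lies in no cell, which costs only a null set.\<close>

lemma grid_sum_eq:
  assumes "s < r" "r \<le> T"
  shows "\<exists>t. s \<le> t \<and> t < r \<and> r \<le> t + (T - s) / real (Suc n) \<and> grid_sum k n \<omega> r = along k \<omega> t"
proof -
  let ?h = "(T - s) / real (Suc n)"
  have h: "0 < ?h" "r \<le> s + real (Suc n) * ?h" using assms by auto
  from grid_sum_indicator[OF h(1) assms(1) h(2), of "\<lambda>j. along k \<omega> (s + real j * ?h)"]
  obtain i where i: "s + real i * ?h < r" "r \<le> s + real (Suc i) * ?h"
      "grid_sum k n \<omega> r = along k \<omega> (s + real i * ?h)"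
    by (auto simp: grid_sum_def)
  moreover have "s + real (Suc i) * ?h = (s + real i * ?h) + ?h"
    unfolding of_nat_Suc distrib_right by linarith
  moreover have "0 \<le> real i * ?h"
    using mult_nonneg_nonneg[of "real i" ?h] h(1) by linarith
  ultimately show ?thesis by (intro exI[of _ "s + real i * ?h"] conjI) linarith+
qed

text \<open>A cadlag path has at most countably many jumps, so its left-endpoint discretizations
  converge to it at almost every time.\<close>

lemma grid_sum_tendsto:
  assumes \<omega>: "\<omega> \<in> paths T" and k: "continuous_on UNIV k"
  shows "AE r in L. (\<lambda>n. grid_sum k n \<omega> r) \<longlonglongrightarrow> along k \<omega> r"
proof -
  let ?q = "along k \<omega>"
  have "countable {r \<in> {s<..T}. \<not> (?q \<longlongrightarrow> ?q r) (at_left r)}"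
  proof (rule countable_left_discontinuities)
    fix r assume "r \<in> {s<..T}"
    with s_nonneg have "r \<in> {0<..T}" by auto
    moreover from \<omega> have "\<forall>t\<in>{0<..T}. \<exists>l. (\<omega> \<longlongrightarrow> l) (at_left t)"
      by (simp add: paths_def cadlag_on_def)
    ultimately obtain l where "(\<omega> \<longlongrightarrow> l) (at_left r)" by blast
    then have "((\<lambda>t. (t, \<omega> t)) \<longlongrightarrow> (r, l)) (at_left r)"
      by (intro tendsto_intros)
    moreover have "isCont k (r, l)" using k by (simp add: continuous_on_eq_continuous_at)
    ultimately have "(?q \<longlongrightarrow> k (r, l)) (at_left r)"
      unfolding along_def[abs_def] by (rule isCont_tendsto_compose[rotated])
    then show "\<exists>l. (?q \<longlongrightarrow> l) (at_left r)" by blast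
  qed
  from AE_interval_measure_countable[OF this, of s T]
    AE_interval_measure_neq[where s=s and t=T and c=s] AE_interval_measure_in[of s T]
  show ?thesis
  proof eventually_elim
    case (elim r)
    then have r: "s < r" "r \<le> T" and cont: "(?q \<longlongrightarrow> ?q r) (at_left r)" by auto
    have "\<exists>t. \<forall>n. s \<le> t n \<and> t n < r \<and> r \<le> t n + (T - s) / real (Suc n) \<and>
        grid_sum k n \<omega> r = ?q (t n)"
      using grid_sum_eq[OF r, of _ k \<omega>] by (intro choice allI) blast
    then obtain t where t: "\<And>n. s \<le> t n" "\<And>n. t n < r"
      "\<And>n. r \<le> t n + (T - s) / real (Suc n)" "\<And>n. grid_sum k n \<omega> r = ?q (t n)"
      by blast
    have "t \<longlonglongrightarrow> r"
    proof (rule tendsto_sandwich[OF always_eventually always_eventually _ tendsto_const])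
      show "(\<lambda>n. r - (T - s) / real (Suc n)) \<longlonglongrightarrow> r"
        using tendsto_diff[OF tendsto_const tendsto_mult[OF tendsto_const LIMSEQ_inverse_real_of_nat], of r "T - s"]
        by (simp add: divide_inverse)
      show "\<forall>n. r - (T - s) / real (Suc n) \<le> t n"
        using t(3) by (auto simp: diff_le_eq)
    qed (use t(2) in \<open>auto intro: less_imp_le\<close>)
    moreover have "t n \<noteq> r" for n using t(2)[of n] by simp
    ultimately have "filterlim t (at_left r) sequentially"
      using t(2) by (auto simp: filterlim_at intro!: always_eventually)
    from filterlim_compose[OF cont this] show ?case by (simp add: t(4))
  qed
qed

text \<open>For a continuous \<open>k\<close> between 0 and 1, summing the increment identity over
  the cells gives equal integrals against \<open>grid_sum k n\<close>; since
  \<open>k \<le> 1\<close>, the density itself dominates and the limit may be taken. The two sides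
  are then integrals of \<open>k\<close> times a density on space-time, where such \<open>k\<close>
  determine the density.\<close>

lemma bracket_density_unique:
  assumes G: "bracket_density M G" and G': "bracket_density M G'"
  shows "AE z in Q \<Otimes>\<^sub>M L. along G (fst z) (snd z) = along G' (fst z) (snd z)"
proof -
  have pos: "0 \<le> H z" and meas: "H \<in> borel_measurable borel" if "bracket_density M H" for H z
    using that unfolding bracket_density_def by blast+
  have term_eq: "(LINT z|(Q \<Otimes>\<^sub>M L). along k (fst z) t * indicator {t<..w} (snd z) * along G (fst z) (snd z)) =
      (LINT z|(Q \<Otimes>\<^sub>M L). along k (fst z) t * indicator {t<..w} (snd z) * along G' (fst z) (snd z))"
    if "k \<in> borel_measurable borel" "\<And>z. 0 \<le> k z" "\<And>z. k z \<le> 1" "s \<le> t" "t \<le> w" "w \<le> T" for k t w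
  proof -
    note that(1)[measurable]
    have "(\<lambda>\<omega>. along k \<omega> t) \<in> borel_measurable Q" by measurable
    with that s_nonneg have *: "t \<in> {0..T}" "(\<lambda>\<omega>. along k \<omega> t) \<in> borel_measurable Q" "\<bar>along k \<omega> t\<bar> \<le> 1" for \<omega>
      by (auto simp: along_def)
    show ?thesis
      using bracket_density_increments(3)[OF G that(4-6) along_adapted[OF *(1) that(1)] *(2,3)]
        bracket_density_increments(3)[OF G' that(4-6) along_adapted[OF *(1) that(1)] *(2,3)]
      by simp
  qed
  have lim: "(\<lambda>n. LINT z|(Q \<Otimes>\<^sub>M L). grid_sum k n (fst z) (snd z) * along H (fst z) (snd z))
      \<longlonglongrightarrow> (LINT z|(Q \<Otimes>\<^sub>M L). along k (fst z) (snd z) * along H (fst z) (snd z))"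
    if H: "bracket_density M H" and k: "continuous_on UNIV k" "\<And>z. 0 \<le> k z" "\<And>z. k z \<le> 1" for H k
  proof (rule integral_dominated_convergence[OF _ _ bracket_density_increments(1)[OF H]])
    have [measurable]: "k \<in> borel_measurable borel" by (rule borel_measurable_continuous_onI[OF k(1)])
    have Hm [measurable]: "H \<in> borel_measurable borel" by (rule meas[OF H])
    have [measurable]: "(\<lambda>z. grid_sum k n (fst z) (snd z)) \<in> borel_measurable (Q \<Otimes>\<^sub>M L)" for n
      unfolding grid_sum_def by measurable
    show "(\<lambda>z. along k (fst z) (snd z) * along H (fst z) (snd z)) \<in> borel_measurable (Q \<Otimes>\<^sub>M L)"
      by measurable
    show "(\<lambda>z. grid_sum k n (fst z) (snd z) * along H (fst z) (snd z)) \<in> borel_measurable (Q \<Otimes>\<^sub>M L)" for n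
      by measurable
    show "AE z in Q \<Otimes>\<^sub>M L. (\<lambda>n. grid_sum k n (fst z) (snd z) * along H (fst z) (snd z))
        \<longlonglongrightarrow> along k (fst z) (snd z) * along H (fst z) (snd z)"
    \<comment> \<open>The exceptional times depend on the path, so the null set is checked path by
      path.\<close>
    proof (rule QL.AE_pair_measure)
      show "{z \<in> space (Q \<Otimes>\<^sub>M L). (\<lambda>n. grid_sum k n (fst z) (snd z) * along H (fst z) (snd z))
        \<longlonglongrightarrow> along k (fst z) (snd z) * along H (fst z) (snd z)} \<in> sets (Q \<Otimes>\<^sub>M L)"
        by measurable
      show "AE \<omega> in Q. AE r in L. (\<lambda>n. grid_sum k n (fst (\<omega>, r)) (snd (\<omega>, r)) * along H (fst (\<omega>, r)) (snd (\<omega>, r)))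
        \<longlonglongrightarrow> along k (fst (\<omega>, r)) (snd (\<omega>, r)) * along H (fst (\<omega>, r)) (snd (\<omega>, r))"
      proof (rule AE_I2)
        fix \<omega> assume "\<omega> \<in> space Q"
        then have "\<omega> \<in> paths T" by (simp add: space_Q)
        from grid_sum_tendsto[OF this k(1)]
        show "AE r in L. (\<lambda>n. grid_sum k n (fst (\<omega>, r)) (snd (\<omega>, r)) * along H (fst (\<omega>, r)) (snd (\<omega>, r)))
          \<longlonglongrightarrow> along k (fst (\<omega>, r)) (snd (\<omega>, r)) * along H (fst (\<omega>, r)) (snd (\<omega>, r))"
          by eventually_elim (auto intro!: tendsto_intros)
      qed
    qed
    show "AE z in Q \<Otimes>\<^sub>M L. norm (grid_sum k n (fst z) (snd z) * along H (fst z) (snd z)) \<le> along H (fst z) (snd z)" for n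
    proof (rule QL.AE_pair_measure)
      show "{z \<in> space (Q \<Otimes>\<^sub>M L). norm (grid_sum k n (fst z) (snd z) * along H (fst z) (snd z)) \<le> along H (fst z) (snd z)} \<in> sets (Q \<Otimes>\<^sub>M L)"
        by measurable
      show "AE \<omega> in Q. AE r in L. norm (grid_sum k n (fst (\<omega>, r)) (snd (\<omega>, r)) * along H (fst (\<omega>, r)) (snd (\<omega>, r)))
        \<le> along H (fst (\<omega>, r)) (snd (\<omega>, r))"
      proof (rule AE_I2)
        fix \<omega>
        show "AE r in L. norm (grid_sum k n (fst (\<omega>, r)) (snd (\<omega>, r)) * along H (fst (\<omega>, r)) (snd (\<omega>, r)))
          \<le> along H (fst (\<omega>, r)) (snd (\<omega>, r))"
          using AE_interval_measure_neq[where s=s and t=T and c=s] AE_interval_measure_in[of s T]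
        proof eventually_elim
          case (elim r)
          then have "s < r" "r \<le> T" by auto
          from grid_sum_eq[OF this, of n k \<omega>] obtain t where "grid_sum k n \<omega> r = along k \<omega> t" by blast
          with k pos[OF H] show ?case by (auto simp: along_def abs_mult intro!: mult_left_le_one_le)
        qed
      qed
    qed
  qed
  have expand: "(LINT z|(Q \<Otimes>\<^sub>M L). grid_sum k n (fst z) (snd z) * along H (fst z) (snd z)) =
      (\<Sum>j<Suc n. LINT z|(Q \<Otimes>\<^sub>M L). along k (fst z) (s + real j * ((T - s) / real (Suc n))) *
         indicator {s + real j * ((T - s) / real (Suc n))<..s + real (Suc j) * ((T - s) / real (Suc n))} (snd z) *
         along H (fst z) (snd z))"
    if H: "bracket_density M H" and k: "k \<in> borel_measurable borel" "\<And>z. 0 \<le> k z" "\<And>z. k z \<le> 1" for H k n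
  proof -
    have Hm [measurable]: "H \<in> borel_measurable borel" by (rule meas[OF H])
    note k(1)[measurable]
    have "integrable (Q \<Otimes>\<^sub>M L) (\<lambda>z. along k (fst z) t * indicator {t<..w} (snd z) * along H (fst z) (snd z))" for t w
    proof (rule Bochner_Integration.integrable_bound[OF bracket_density_increments(1)[OF H]])
      have "\<bar>along k \<omega> t * indicator {t<..w} r * along H \<omega> r\<bar> \<le> \<bar>along H \<omega> r\<bar>" for \<omega> r
        using k(2,3) by (auto simp: along_def indicator_def abs_mult intro!: mult_left_le_one_le)
      then show "AE z in Q \<Otimes>\<^sub>M L. norm (along k (fst z) t * indicator {t<..w} (snd z) * along H (fst z) (snd z)) \<le> norm (along H (fst z) (snd z))"
        by simp
    qed measurable
    then show ?thesis
      unfolding grid_sum_def sum_distrib_right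
      by (subst Bochner_Integration.integral_sum[symmetric]) (simp_all only: mult.commute)
  qed
  \<comment> \<open>The occupation measure of the space-time process (r, X_r) on
    \<open>[s,T]\<close>.\<close>
  define N where "N = distr (Q \<Otimes>\<^sub>M L) borel (\<lambda>z. (snd z, fst z (snd z)))"
  have ev [measurable]: "(\<lambda>z. (snd z, fst z (snd z))) \<in> measurable (Q \<Otimes>\<^sub>M L) (borel :: (real \<times> 'e) measure)"
  proof -
    have "(\<lambda>z. fst z (snd z)) \<in> measurable (Q \<Otimes>\<^sub>M L) (borel :: 'e measure)"
      using measurable_eval measurable_cong_sets[OF sets_pair_measure_cong[OF refl sets_interval_measure] refl]
      by (fastforce simp: case_prod_beta')
    then show ?thesis by (simp add: borel_prod[symmetric])
  qed
  have int_N: "integrable N H" if "bracket_density M H" for H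
    unfolding N_def using bracket_density_increments(1)[OF that] meas[OF that]
    by (subst integrable_distr_eq[OF ev]) (auto simp: along_def)
  have "AE z in N. G z = G' z"
  proof (rule finite_measure_eqI_continuous_densities[OF _ int_N[OF G] pos[OF G] int_N[OF G'] pos[OF G']])
    show "sets N = sets borel" by (simp add: N_def)
    fix k :: "real \<times> 'e \<Rightarrow> real"
    assume k: "continuous_on UNIV k" "\<And>z. 0 \<le> k z" "\<And>z. k z \<le> 1"
    have km [measurable]: "k \<in> borel_measurable borel" by (rule borel_measurable_continuous_onI[OF k(1)])
    have grid: "s \<le> s + real j * ((T - s) / real (Suc n))"
        "s + real j * ((T - s) / real (Suc n)) \<le> s + real (Suc j) * ((T - s) / real (Suc n))"
        "s + real (Suc j) * ((T - s) / real (Suc n)) \<le> T" if "j < Suc n" for j n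
    proof -
      let ?h = "(T - s) / real (Suc n)"
      have h: "0 \<le> ?h" using s_le_T by simp
      show "s \<le> s + real j * ?h" using mult_nonneg_nonneg[OF _ h, of "real j"] by simp
      show "s + real j * ?h \<le> s + real (Suc j) * ?h" using mult_right_mono[OF _ h, of "real j" "real (Suc j)"] by simp
      have "real (Suc j) * ?h \<le> real (Suc n) * ?h" using that by (intro mult_right_mono[OF _ h]) simp
      then show "s + real (Suc j) * ?h \<le> T" by (simp del: of_nat_Suc)
    qed
    have "(LINT z|(Q \<Otimes>\<^sub>M L). grid_sum k n (fst z) (snd z) * along G (fst z) (snd z)) =
        (LINT z|(Q \<Otimes>\<^sub>M L). grid_sum k n (fst z) (snd z) * along G' (fst z) (snd z))" for n
      unfolding expand[OF G km k(2,3)] expand[OF G' km k(2,3)]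
      by (intro sum.cong refl term_eq[OF km k(2,3)] grid) auto
    with lim[OF G k] lim[OF G' k]
    have "(LINT z|(Q \<Otimes>\<^sub>M L). along k (fst z) (snd z) * along G (fst z) (snd z)) =
        (LINT z|(Q \<Otimes>\<^sub>M L). along k (fst z) (snd z) * along G' (fst z) (snd z))"
      by (simp add: LIMSEQ_unique)
    then show "(LINT z|N. k z * G z) = (LINT z|N. k z * G' z)"
      unfolding N_def using meas[OF G] meas[OF G']
      by (subst (1 2) integral_distr[OF ev]) (auto simp: along_def)
  qed
  then show ?thesis
    unfolding N_def using meas[OF G] meas[OF G']
    by (subst (asm) AE_distr_iff[OF ev]) (auto simp: along_def)
qed

end

section \<open>The energy identity\<close>

text \<open>Cauchy-Schwarz against the constant 1. With m the total mass and c the integral of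
  \<open>h\<close>, the integral of the square of m h - c is nonnegative; multiplying
  \<open>h\<close> by m instead of dividing c by it leaves m = 0 to the very end.\<close>

lemma (in finite_measure) integral_power2_le:
  fixes h :: "'a \<Rightarrow> real"
  assumes [measurable]: "h \<in> borel_measurable M" and sq: "integrable M (\<lambda>x. (h x)\<^sup>2)"
  shows "(LINT x|M. h x)\<^sup>2 \<le> measure M (space M) * (LINT x|M. (h x)\<^sup>2)"
proof -
  let ?m = "measure M (space M)" and ?c = "LINT x|M. h x"
  have h: "integrable M h" by (rule square_integrable_imp_integrable[OF _ sq]) measurable
  have "0 \<le> (LINT x|M. (?m * h x - ?c)\<^sup>2)" by simp
  also have "\<dots> = (LINT x|M. ?m\<^sup>2 * (h x)\<^sup>2 - 2 * ?m * ?c * h x + ?c\<^sup>2)"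
    by (intro Bochner_Integration.integral_cong) (auto simp: power2_eq_square algebra_simps)
  also have "\<dots> = ?m\<^sup>2 * (LINT x|M. (h x)\<^sup>2) - 2 * ?m * ?c * ?c + ?c\<^sup>2 * ?m"
    using h sq by simp
  also have "\<dots> = ?m * (?m * (LINT x|M. (h x)\<^sup>2) - ?c\<^sup>2)"
    by (simp add: power2_eq_square algebra_simps)
  finally have le: "0 \<le> ?m * (?m * (LINT x|M. (h x)\<^sup>2) - ?c\<^sup>2)" .
  show ?thesis
  proof (cases "?m = 0")
    case True
    then have "space M \<in> null_sets M"
      by (simp add: null_sets_def emeasure_eq_measure)
    then have "AE x in M. h x = 0"
      by (rule AE_I'[where N="space M"]) auto
    then have "?c = 0" by (simp add: integral_eq_zero_AE)
    with True show ?thesis by simp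
  next
    case False
    then have "0 < ?m" by (simp add: zero_less_measure_iff)
    with le show ?thesis by (simp add: zero_le_mult_iff)
  qed
qed

text \<open>The squared integral is a double integral over a square, which the diagonal cuts into
  two triangles exchanged by Fubini. Applied to \<psi> along a path, it expresses V_T^2 through the
  time integral of \<psi>(r, X_r) V_r.\<close>

lemma integral_triangle:
  fixes h :: "real \<Rightarrow> real"
  assumes [measurable]: "h \<in> borel_measurable borel" and int: "integrable (interval_measure s t) h"
  shows "(LINT r|interval_measure s t. h r)\<^sup>2 =
    2 * (LINT r|interval_measure s t. h r * (LINT q|interval_measure s t. indicator {..r} q * h q))"
proof -
  let ?L = "interval_measure s t"
  interpret L: finite_measure ?L by (rule finite_measure_interval_measure)
  interpret LL: pair_sigma_finite ?L ?L ..
  let ?W = "\<lambda>r. LINT q|?L. indicator {..r} q * h q"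
  let ?W' = "\<lambda>r. LINT q|?L. indicator {r<..} q * h q"
  let ?I = "LINT r|?L. h r"
  have ind: "indicator {r<..} q = (if r < q then 1 else 0 :: real)"
     "indicator {..r} q = (if q \<le> r then 1 else 0 :: real)" for q r :: real by simp_all
  have [measurable]: "?W \<in> borel_measurable borel" "?W' \<in> borel_measurable borel"
    unfolding ind by measurable
  have part: "integrable ?L (\<lambda>q. indicator A q * h q)" if "A \<in> sets borel" for A
    using integrable_mult_indicator[of A ?L h] int that by simp
  have sum: "?W r + ?W' r = ?I" for r
  proof -
    have "?W r + ?W' r = (LINT q|?L. indicator {..r} q * h q + indicator {r<..} q * h q)"
      by (rule Bochner_Integration.integral_add[symmetric]; rule part) auto
    also have "\<dots> = ?I" by (intro Bochner_Integration.integral_cong) (auto simp: indicator_def)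
    finally show ?thesis .
  qed
  have sq: "integrable (?L \<Otimes>\<^sub>M ?L) (\<lambda>z. h (fst z) * h (snd z))"
    using int by (intro LL.Fubini_integrable) (auto simp: abs_mult)
  have tri: "integrable (?L \<Otimes>\<^sub>M ?L) (\<lambda>(r, q). h r * (indicator {r<..} q * h q))"
    unfolding ind
    by (rule Bochner_Integration.integrable_bound[OF sq]) (auto simp: abs_mult split: prod.split)
  have tri': "integrable (?L \<Otimes>\<^sub>M ?L) (\<lambda>(r, q). h r * (indicator {..r} q * h q))"
    unfolding ind
    by (rule Bochner_Integration.integrable_bound[OF sq]) (auto simp: abs_mult split: prod.split)
  have W: "integrable ?L (\<lambda>r. h r * ?W r)" and W': "integrable ?L (\<lambda>r. h r * ?W' r)"
    using LL.integrable_fst[OF tri'] LL.integrable_fst[OF tri] by simp_all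
  have "(LINT r|?L. h r * ?W' r) = (LINT r|?L. LINT q|?L. h r * (indicator {r<..} q * h q))"
    by simp
  also have "\<dots> = (LINT q|?L. LINT r|?L. h r * (indicator {r<..} q * h q))"
    using LL.Fubini_integral[OF tri] by simp
  also have "\<dots> = (LINT q|?L. h q * ?W q)"
  proof (rule Bochner_Integration.integral_cong[OF refl])
    fix q
    have "(LINT r|?L. h r * (indicator {r<..} q * h q)) = (LINT r|?L. h q * (indicator {..q} r * h r))"
      unfolding ind
    proof (rule integral_cong_AE)
      \<comment> \<open>Exchanging the variables gives the triangle \<open>r < q\<close> instead of
        \<open>r \<le> q\<close>; they differ only at the time \<open>r = q\<close>.\<close>
      show "AE r in ?L. h r * ((if r < q then 1 else 0) * h q) = h q * ((if r \<le> q then 1 else 0) * h r)"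
        using AE_interval_measure_neq[where s=s and t=t and c=q] by eventually_elim auto
    qed measurable
    then show "(LINT r|?L. h r * (indicator {r<..} q * h q)) = h q * ?W q" by simp
  qed
  finally have "(LINT r|?L. h r * ?W r + h r * ?W' r) = 2 * (LINT r|?L. h r * ?W r)"
    using W W' by simp
  moreover have "(LINT r|?L. h r * ?W r + h r * ?W' r) = ?I\<^sup>2"
    unfolding distrib_left[symmetric] sum by (simp add: power2_eq_square)
  ultimately show ?thesis by simp
qed

lemma abs_powr_two: "\<bar>y\<bar> powr 2 = y\<^sup>2" for y :: real
  by (cases "y = 0") simp_all

section \<open>The first two moments of u(T, X_T)\<close>

context canonical_start
begin

lemma integrable_fst_comp:
  fixes h :: "(real \<Rightarrow> 'e) \<Rightarrow> real"
  assumes "integrable Q h"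
  shows "integrable (Q \<Otimes>\<^sub>M L) (\<lambda>z. h (fst z))"
  using assms by (intro QL.Fubini_integrable) auto

lemma measure_L: "measure L UNIV = T - s"
  using s_le_T by (simp add: measure_def emeasure_interval_measure_UNIV)

text \<open>The second claim is the expectation of Ito's formula for the square of u(t, X_t). The
  hypotheses \<open>u2\<close> and \<open>p2\<close> make all products over law and time integrable,
  so that expectations and time integrals may be exchanged.\<close>

lemma energy_identity:
  fixes u \<psi> :: "real \<times> 'e \<Rightarrow> real"
  assumes um [measurable]: "u \<in> borel_measurable borel" and pm [measurable]: "\<psi> \<in> borel_measurable borel"
    and u2: "integrable (Q \<Otimes>\<^sub>M L) (\<lambda>z. (along u (fst z) (snd z))\<^sup>2)"
    and p2: "integrable (Q \<Otimes>\<^sub>M L) (\<lambda>z. (along \<psi> (fst z) (snd z))\<^sup>2)"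
    and mod: "martingale_modification T Q s x u \<psi> M"
  shows "(LINT \<omega>|Q. along u \<omega> T) = u (s, x) + (LINT z|(Q \<Otimes>\<^sub>M L). along \<psi> (fst z) (snd z))" (is ?mean)
    and "(LINT \<omega>|Q. (along u \<omega> T)\<^sup>2) = (u (s, x))\<^sup>2 + (LINT \<omega>|completion Q. (M T \<omega>)\<^sup>2)
      + 2 * (LINT z|(Q \<Otimes>\<^sub>M L). along \<psi> (fst z) (snd z) * along u (fst z) (snd z))" (is ?energy)
proof -
  define c where "c = u (s, x)"
  \<comment> \<open>Jointly measurable in time and path, and almost surely equal to
    \<open>M r\<close> at each fixed \<open>r\<close> in \<open>[s,T]\<close>: Fubini is applied to
    \<open>N\<close>, the martingale property to \<open>M\<close>.\<close>
  define N where "N r \<omega> = along u \<omega> r - c - int_to \<psi> r \<omega>" for r \<omega>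
  have [measurable]: "(\<lambda>z. N (h z) (f z)) \<in> borel_measurable R"
    if [measurable]: "f \<in> measurable R Q" "h \<in> borel_measurable R" for R :: "'z measure" and f h
    unfolding N_def by measurable
  have M: "M \<in> H2_0 T Q" using mod by (simp add: martingale_modification_def)
  have mart: "martingale (completion Q) (completed_filtration T Q) {0..T} M"
    using M by (simp add: H2_0_def)
  have T: "T \<in> {0..T}" "0 \<in> {0..T}" "T \<in> {s..T}" using T_nonneg s_le_T by auto
  have [measurable]: "M r \<in> borel_measurable (completion Q)" if "r \<in> {0..T}" for r
    by (rule H2_0_measurable[OF M that])
  have path: "AE \<omega> in completion Q. \<omega> \<in> paths T"
    using AE_space[of "completion Q"] by (simp add: space_Q)
  have MN: "AE \<omega> in completion Q. M r \<omega> = N r \<omega>" if r: "r \<in> {s..T}" for r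
  proof -
    have "r \<in> {0..T}" using r s_nonneg by auto
    with mod have "AE \<omega> in completion Q. M r \<omega> = (if s \<le> r then u (r, \<omega> r) - u (s, x) - path_integral \<psi> s r \<omega> else 0)"
      by (auto simp: martingale_modification_def)
    with path show ?thesis
      by eventually_elim (use r in \<open>auto simp: N_def c_def along_def path_integral_eq_int_to\<close>)
  qed
  have M2: "integrable (completion Q) (\<lambda>\<omega>. (M r \<omega>)\<^sup>2)" if "r \<in> {0..T}" for r
    by (rule H2_0_square_integrable[OF M that])

  have Z: "integrable Q (\<lambda>\<omega>. LINT r|L. (along \<psi> \<omega> r)\<^sup>2)"
    and Z_ae: "AE \<omega> in Q. integrable L (\<lambda>r. (along \<psi> \<omega> r)\<^sup>2)"
    using QL.integrable_fst[of "\<lambda>\<omega> r. (along \<psi> \<omega> r)\<^sup>2"] QL.AE_integrable_fst[of "\<lambda>\<omega> r. (along \<psi> \<omega> r)\<^sup>2"] p2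
    by (simp_all add: case_prod_beta')
  \<comment> \<open>One null set serves all \<open>r\<close>, and the bound does not depend on
    \<open>r\<close>; hence V is square integrable over law and time as well as at
    \<open>T\<close>.\<close>
  have V_bound: "AE \<omega> in Q. \<forall>r. (int_to \<psi> r \<omega>)\<^sup>2 \<le> (T - s) * (LINT q|L. (along \<psi> \<omega> q)\<^sup>2)"
    using Z_ae AE_space
  proof eventually_elim
    case (elim \<omega>)
    then have [measurable]: "along \<psi> \<omega> \<in> borel_measurable borel" by (intro measurable_along_path) (auto simp: space_Q)
    show ?case
    proof
      fix r
      have [measurable]: "(\<lambda>q. indicator {..r} q * along \<psi> \<omega> q) \<in> borel_measurable L" by measurable
      have le: "(indicator {..r} q * along \<psi> \<omega> q)\<^sup>2 \<le> (along \<psi> \<omega> q)\<^sup>2" for q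
        by (auto simp: indicator_def)
      have i: "integrable L (\<lambda>q. (indicator {..r} q * along \<psi> \<omega> q)\<^sup>2)"
        by (rule Bochner_Integration.integrable_bound[OF elim(1)]) (use le in auto)
      have "(int_to \<psi> r \<omega>)\<^sup>2 \<le> (T - s) * (LINT q|L. (indicator {..r} q * along \<psi> \<omega> q)\<^sup>2)"
        using L.integral_power2_le[OF _ i] by (simp add: int_to_def measure_L)
      also have "\<dots> \<le> (T - s) * (LINT q|L. (along \<psi> \<omega> q)\<^sup>2)"
        using s_le_T by (intro mult_left_mono integral_mono i elim(1) le) auto
      finally show "(int_to \<psi> r \<omega>)\<^sup>2 \<le> (T - s) * (LINT q|L. (along \<psi> \<omega> q)\<^sup>2)" .
    qed
  qed
  have V2: "integrable (Q \<Otimes>\<^sub>M L) (\<lambda>z. (int_to \<psi> (snd z) (fst z))\<^sup>2)"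
  proof (rule Bochner_Integration.integrable_bound)
    show "integrable (Q \<Otimes>\<^sub>M L) (\<lambda>z. (T - s) * (LINT q|L. (along \<psi> (fst z) q)\<^sup>2))"
      using integrable_fst_comp[OF Z] by simp
    have nn: "0 \<le> (T - s) * (LINT q|L. (along \<psi> \<omega> q)\<^sup>2)" for \<omega> using s_le_T by simp
    show "AE z in Q \<Otimes>\<^sub>M L. norm ((int_to \<psi> (snd z) (fst z))\<^sup>2) \<le> norm ((T - s) * (LINT q|L. (along \<psi> (fst z) q)\<^sup>2))"
    proof (rule QL.AE_pair_measure)
      show "AE \<omega> in Q. AE r in L. norm ((int_to \<psi> (snd (\<omega>, r)) (fst (\<omega>, r)))\<^sup>2)
          \<le> norm ((T - s) * (LINT q|L. (along \<psi> (fst (\<omega>, r)) q)\<^sup>2))"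
        using V_bound by eventually_elim (simp add: abs_of_nonneg[OF nn])
    qed measurable
  qed measurable
  have VT2: "integrable Q (\<lambda>\<omega>. (int_to \<psi> T \<omega>)\<^sup>2)"
  proof (rule Bochner_Integration.integrable_bound)
    show "integrable Q (\<lambda>\<omega>. (T - s) * (LINT q|L. (along \<psi> \<omega> q)\<^sup>2))" using Z by simp
    show "AE \<omega> in Q. norm ((int_to \<psi> T \<omega>)\<^sup>2) \<le> norm ((T - s) * (LINT q|L. (along \<psi> \<omega> q)\<^sup>2))"
      using V_bound by eventually_elim (use s_le_T in \<open>simp add: abs_mult\<close>)
  qed measurable
  have NT2: "integrable Q (\<lambda>\<omega>. (N T \<omega>)\<^sup>2)"
  proof -
    have eq: "AE \<omega> in completion Q. (M T \<omega>)\<^sup>2 = (N T \<omega>)\<^sup>2" using MN[OF T(3)] by eventually_elim simp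
    have "integrable (completion Q) (\<lambda>\<omega>. (N T \<omega>)\<^sup>2)"
      by (rule iffD1[OF integrable_cong_AE[OF _ _ eq] M2[OF T(1)]])
        (use T in \<open>auto intro!: measurable_completion\<close>)
    then show ?thesis by (subst (asm) integrable_completion) auto
  qed
  \<comment> \<open>The hypothesis \<open>u2\<close> controls almost every time but not the single
    time \<open>T\<close>; there the moment is recovered from M_T and V_T.\<close>
  have UT2: "integrable Q (\<lambda>\<omega>. (along u \<omega> T)\<^sup>2)"
  proof -
    have "integrable Q (\<lambda>\<omega>. (N T \<omega> + c + int_to \<psi> T \<omega>)\<^sup>2)"
      by (intro integrable_add_squares NT2 VT2) auto
    then show ?thesis by (simp add: N_def)
  qed
  have V: "integrable Q (int_to \<psi> T)" and U: "integrable Q (\<lambda>\<omega>. along u \<omega> T)"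
    using square_integrable_imp_integrable[OF _ VT2] square_integrable_imp_integrable[OF _ UT2] by simp_all
  have p1: "integrable (Q \<Otimes>\<^sub>M L) (\<lambda>z. along \<psi> (fst z) (snd z))"
    by (rule QL_finite.square_integrable_imp_integrable[OF _ p2]) measurable
  have EV: "(LINT \<omega>|Q. int_to \<psi> T \<omega>) = (LINT z|(Q \<Otimes>\<^sub>M L). along \<psi> (fst z) (snd z))"
  proof -
    have "(LINT \<omega>|Q. int_to \<psi> T \<omega>) = (LINT \<omega>|Q. LINT r|L. along \<psi> \<omega> r)"
      by (intro Bochner_Integration.integral_cong) (auto simp: int_to_T space_Q)
    then show ?thesis using QL.integral_fst[of "along \<psi>"] p1 by (simp add: case_prod_beta')
  qed
  have "(LINT \<omega>|Q. N T \<omega>) = (LINT \<omega>|completion Q. N T \<omega>)"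
    by (rule integral_completion[symmetric]) measurable
  also have "\<dots> = (LINT \<omega>|completion Q. 1 * M T \<omega>)"
    by (rule integral_cong_AE) (use T MN[OF T(3)] in \<open>auto intro!: measurable_completion\<close>)
  also have "\<dots> = (LINT \<omega>|completion Q. 1 * M 0 \<omega>)"
    using T T_nonneg K.square_integrable_imp_integrable[OF _ M2[OF T(1)]]
    by (intro martingale_integral_mult(2)[OF mart finite_measure_subalgebra_filtration]) auto
  also have "\<dots> = 0"
    using M by (intro integral_eq_zero_AE) (auto simp: H2_0_def)
  finally have mean: "(LINT \<omega>|Q. along u \<omega> T) = c + (LINT \<omega>|Q. int_to \<psi> T \<omega>)"
    using U V by (simp add: N_def prob_space)
  then show ?mean by (simp add: EV c_def)

  have orth: "AE r in L. (LINT \<omega>|Q. along \<psi> \<omega> r * (N T \<omega> - N r \<omega>)) = 0"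
  proof -
    \<comment> \<open>Square integrability over law and time gives a finite second moment of
      \<psi>(r, X_r) for almost every \<open>r\<close> only, hence the restriction in
      \<open>orth\<close>.\<close>
    have "AE r in L. integrable Q (\<lambda>\<omega>. (along \<psi> \<omega> r)\<^sup>2)"
      using QL.AE_integrable_snd[of "\<lambda>\<omega> r. (along \<psi> \<omega> r)\<^sup>2"] p2 by (simp add: case_prod_beta')
    then show ?thesis using AE_interval_measure_in[of s T]
    proof eventually_elim
      case (elim r)
      then have r: "r \<in> {0..T}" "r \<in> {s..T}" using s_nonneg by auto
      have B2: "integrable (completion Q) (\<lambda>\<omega>. (along \<psi> \<omega> r)\<^sup>2)"
        using elim by (subst integrable_completion) auto
      have B [measurable]: "(\<lambda>\<omega>. along \<psi> \<omega> r) \<in> borel_measurable (completion Q)"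
        by (rule measurable_completion) measurable
      have BM: "integrable (completion Q) (\<lambda>\<omega>. along \<psi> \<omega> r * M t \<omega>)" if "t \<in> {0..T}" for t
        using that by (intro integrable_mult_of_squares B2 M2) auto
      have "(LINT \<omega>|completion Q. along \<psi> \<omega> r * M T \<omega>) = (LINT \<omega>|completion Q. along \<psi> \<omega> r * M r \<omega>)"
        using T r by (intro martingale_integral_mult(2)[OF mart finite_measure_subalgebra_filtration] along_adapted BM) auto
      then have "(LINT \<omega>|completion Q. along \<psi> \<omega> r * (M T \<omega> - M r \<omega>)) = 0"
        using BM[OF T(1)] BM[OF r(1)] by (simp add: right_diff_distrib)
      moreover have "(LINT \<omega>|completion Q. along \<psi> \<omega> r * (M T \<omega> - M r \<omega>)) =
          (LINT \<omega>|completion Q. along \<psi> \<omega> r * (N T \<omega> - N r \<omega>))"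
      proof (rule integral_cong_AE)
        show "AE \<omega> in completion Q. along \<psi> \<omega> r * (M T \<omega> - M r \<omega>) = along \<psi> \<omega> r * (N T \<omega> - N r \<omega>)"
          using MN[OF T(3)] MN[OF r(2)] by eventually_elim simp
      qed (use T r in \<open>auto intro!: measurable_completion\<close>)
      moreover have "\<dots> = (LINT \<omega>|Q. along \<psi> \<omega> r * (N T \<omega> - N r \<omega>))"
        by (rule integral_completion) measurable
      ultimately show ?case by simp
    qed
  qed
  have pU: "integrable (Q \<Otimes>\<^sub>M L) (\<lambda>z. along \<psi> (fst z) (snd z) * along u (fst z) (snd z))"
    by (intro integrable_mult_of_squares p2 u2) measurable
  have pV: "integrable (Q \<Otimes>\<^sub>M L) (\<lambda>z. along \<psi> (fst z) (snd z) * int_to \<psi> (snd z) (fst z))"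
    by (intro integrable_mult_of_squares p2 V2) measurable
  \<comment> \<open>Against a variable \<open>Y\<close> free of time, the time integral of \<psi>
    collapses to V_T.\<close>
  have pfst: "integrable (Q \<Otimes>\<^sub>M L) (\<lambda>z. along \<psi> (fst z) (snd z) * Y (fst z))"
    and pfst_eq: "(LINT z|(Q \<Otimes>\<^sub>M L). along \<psi> (fst z) (snd z) * Y (fst z)) = (LINT \<omega>|Q. int_to \<psi> T \<omega> * Y \<omega>)"
    if [measurable]: "Y \<in> borel_measurable Q" and Y2: "integrable Q (\<lambda>\<omega>. (Y \<omega>)\<^sup>2)" for Y
  proof -
    show i: "integrable (Q \<Otimes>\<^sub>M L) (\<lambda>z. along \<psi> (fst z) (snd z) * Y (fst z))"
      by (intro integrable_mult_of_squares p2 integrable_fst_comp[OF Y2]) measurable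
    have "(LINT \<omega>|Q. int_to \<psi> T \<omega> * Y \<omega>) = (LINT \<omega>|Q. LINT r|L. along \<psi> \<omega> r * Y \<omega>)"
      by (intro Bochner_Integration.integral_cong) (auto simp: int_to_T space_Q)
    then show "(LINT z|(Q \<Otimes>\<^sub>M L). along \<psi> (fst z) (snd z) * Y (fst z)) = (LINT \<omega>|Q. int_to \<psi> T \<omega> * Y \<omega>)"
      using QL.integral_fst[of "\<lambda>\<omega> r. along \<psi> \<omega> r * Y \<omega>"] i by (simp add: case_prod_beta')
  qed
  have tri: "(LINT \<omega>|Q. (int_to \<psi> T \<omega>)\<^sup>2) = 2 * (LINT z|(Q \<Otimes>\<^sub>M L). along \<psi> (fst z) (snd z) * int_to \<psi> (snd z) (fst z))"
  proof -
    have "(LINT \<omega>|Q. (int_to \<psi> T \<omega>)\<^sup>2) = (LINT \<omega>|Q. 2 * (LINT r|L. along \<psi> \<omega> r * int_to \<psi> r \<omega>))"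
    proof (rule integral_cong_AE)
      show "AE \<omega> in Q. (int_to \<psi> T \<omega>)\<^sup>2 = 2 * (LINT r|L. along \<psi> \<omega> r * int_to \<psi> r \<omega>)"
        using Z_ae AE_space
      proof eventually_elim
        case (elim \<omega>)
        then have \<omega>: "\<omega> \<in> paths T" by (simp add: space_Q)
        have [measurable]: "along \<psi> \<omega> \<in> borel_measurable borel" by (rule measurable_along_path[OF pm \<omega>])
        have "integrable L (along \<psi> \<omega>)"
          by (rule L.square_integrable_imp_integrable[OF _ elim(1)]) measurable
        from integral_triangle[OF _ this] show ?case
          unfolding int_to_T[OF pm \<omega>] by (simp add: int_to_def)
      qed
    qed measurable
    then show ?thesis
      using QL.integral_fst[of "\<lambda>\<omega> r. along \<psi> \<omega> r * int_to \<psi> r \<omega>"] pV by (simp add: case_prod_beta')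
  qed
  \<comment> \<open>\<open>N T\<close> without its constant, which cancels in
    \<open>N T - N r\<close>.\<close>
  define X where "X \<omega> = along u \<omega> T - int_to \<psi> T \<omega>" for \<omega>
  have Xm [measurable]: "X \<in> borel_measurable Q" unfolding X_def by measurable
  have X2: "integrable Q (\<lambda>\<omega>. (X \<omega>)\<^sup>2)"
    using integrable_add_squares[of "\<lambda>\<omega>. along u \<omega> T" Q "\<lambda>\<omega>. - int_to \<psi> T \<omega>"] UT2 VT2 by (simp add: X_def)
  have UV: "integrable Q (\<lambda>\<omega>. int_to \<psi> T \<omega> * along u \<omega> T)"
    by (intro integrable_mult_of_squares UT2 VT2) measurable
  let ?pU = "LINT z|(Q \<Otimes>\<^sub>M L). along \<psi> (fst z) (snd z) * along u (fst z) (snd z)"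
  let ?pV = "LINT z|(Q \<Otimes>\<^sub>M L). along \<psi> (fst z) (snd z) * int_to \<psi> (snd z) (fst z)"
  have split: "along \<psi> \<omega> r * (N T \<omega> - N r \<omega>) =
      along \<psi> \<omega> r * X \<omega> - along \<psi> \<omega> r * along u \<omega> r + along \<psi> \<omega> r * int_to \<psi> r \<omega>" for \<omega> r
    by (simp add: N_def X_def algebra_simps)
  have pi: "integrable (Q \<Otimes>\<^sub>M L) (\<lambda>z. along \<psi> (fst z) (snd z) * (N T (fst z) - N (snd z) (fst z)))"
    unfolding split using pfst[OF Xm X2] pU pV by simp
  have "0 = (LINT r|L. LINT \<omega>|Q. along \<psi> \<omega> r * (N T \<omega> - N r \<omega>))"
    using orth by (intro integral_eq_zero_AE[symmetric]) auto
  also have "\<dots> = (LINT z|(Q \<Otimes>\<^sub>M L). along \<psi> (fst z) (snd z) * (N T (fst z) - N (snd z) (fst z)))"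
    using QL.integral_snd[of "\<lambda>\<omega> r. along \<psi> \<omega> r * (N T \<omega> - N r \<omega>)"] pi by (simp add: case_prod_beta')
  also have "\<dots> = (LINT \<omega>|Q. int_to \<psi> T \<omega> * X \<omega>) - ?pU + ?pV"
    unfolding split using pfst[OF Xm X2] pU pV by (simp add: pfst_eq[OF Xm X2])
  also have "(LINT \<omega>|Q. int_to \<psi> T \<omega> * X \<omega>) = (LINT \<omega>|Q. int_to \<psi> T \<omega> * along u \<omega> T) - (LINT \<omega>|Q. (int_to \<psi> T \<omega>)\<^sup>2)"
    using UV VT2 by (simp add: X_def right_diff_distrib power2_eq_square)
  \<comment> \<open>Orthogonality reads 0 = E[V_T X] - \<open>?pU\<close> + \<open>?pV\<close>, and
    by \<open>tri\<close> twice \<open>?pV\<close> is E[V_T^2].\<close>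
  finally have pU_eq: "2 * ?pU = 2 * (LINT \<omega>|Q. int_to \<psi> T \<omega> * along u \<omega> T) - (LINT \<omega>|Q. (int_to \<psi> T \<omega>)\<^sup>2)"
    using tri by simp
  have "(LINT \<omega>|completion Q. (M T \<omega>)\<^sup>2) = (LINT \<omega>|completion Q. (N T \<omega>)\<^sup>2)"
  proof (rule integral_cong_AE)
    show "AE \<omega> in completion Q. (M T \<omega>)\<^sup>2 = (N T \<omega>)\<^sup>2" using MN[OF T(3)] by eventually_elim simp
  qed (use T in \<open>auto intro!: measurable_completion\<close>)
  also have "\<dots> = (LINT \<omega>|Q. (N T \<omega>)\<^sup>2)" by (rule integral_completion) measurable
  also have "\<dots> = (LINT \<omega>|Q. (along u \<omega> T)\<^sup>2 + (int_to \<psi> T \<omega>)\<^sup>2 - 2 * (int_to \<psi> T \<omega> * along u \<omega> T)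
      - 2 * c * along u \<omega> T + 2 * c * int_to \<psi> T \<omega> + c\<^sup>2)"
    by (intro Bochner_Integration.integral_cong) (auto simp: N_def power2_eq_square algebra_simps)
  also have "\<dots> = (LINT \<omega>|Q. (along u \<omega> T)\<^sup>2) + (LINT \<omega>|Q. (int_to \<psi> T \<omega>)\<^sup>2)
      - 2 * (LINT \<omega>|Q. int_to \<psi> T \<omega> * along u \<omega> T)
      - 2 * c * (LINT \<omega>|Q. along u \<omega> T) + 2 * c * (LINT \<omega>|Q. int_to \<psi> T \<omega>) + c\<^sup>2"
    using UT2 VT2 UV U V by (simp add: prob_space)
  \<comment> \<open>By \<open>mean\<close>, E[u(T, X_T)] - E[V_T] is \<open>c\<close>, so the terms
    containing \<open>c\<close> add up to -2 c^2 + c^2.\<close>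
  also have "\<dots> = (LINT \<omega>|Q. (along u \<omega> T)\<^sup>2) - 2 * ?pU - c\<^sup>2"
    unfolding pU_eq mean by (simp add: power2_eq_square algebra_simps)
  finally show ?energy by (simp add: c_def)
qed

end

section \<open>The identification problem\<close>

context canonical_start
begin

text \<open>Tonelli, turning the iterated integrals in \<open>LpX\<close> and
  \<open>zero_potential\<close> into integrals over the product of law and time.\<close>

lemma nn_integral_occupation:
  fixes h :: "real \<times> 'e \<Rightarrow> ennreal"
  assumes [measurable]: "h \<in> borel_measurable borel"
  shows "(\<integral>\<^sup>+ z. h (snd z, fst z (snd z)) \<partial>(Q \<Otimes>\<^sub>M L)) =
    (\<integral>\<^sup>+ \<omega>. (\<integral>\<^sup>+ r\<in>{s..T}. h (r, \<omega> r) \<partial>lborel) \<partial>Q)"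
    and "(\<lambda>z. h (snd z, fst z (snd z))) \<in> borel_measurable (Q \<Otimes>\<^sub>M L)"
proof -
  have ev: "(\<lambda>z. (snd z, fst z (snd z))) \<in> measurable (Q \<Otimes>\<^sub>M borel) (borel :: (real \<times> 'e) measure)"
  proof -
    have "(\<lambda>z. fst z (snd z)) \<in> measurable (Q \<Otimes>\<^sub>M borel) (borel :: 'e measure)"
      using measurable_eval by (simp add: case_prod_beta')
    then show ?thesis by (simp add: borel_prod[symmetric])
  qed
  from measurable_compose[OF this assms]
  have m: "(\<lambda>z. h (snd z, fst z (snd z))) \<in> borel_measurable (Q \<Otimes>\<^sub>M borel)" .
  then show m': "(\<lambda>z. h (snd z, fst z (snd z))) \<in> borel_measurable (Q \<Otimes>\<^sub>M L)"
    using measurable_cong_sets[OF sets_pair_measure_cong[OF refl sets_interval_measure] refl] by blast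
  show "(\<integral>\<^sup>+ z. h (snd z, fst z (snd z)) \<partial>(Q \<Otimes>\<^sub>M L)) =
      (\<integral>\<^sup>+ \<omega>. (\<integral>\<^sup>+ r\<in>{s..T}. h (r, \<omega> r) \<partial>lborel) \<partial>Q)"
  proof (subst L.nn_integral_fst[OF m', symmetric], rule nn_integral_cong)
    fix \<omega> assume "\<omega> \<in> space Q"
    then have "(\<lambda>r. (\<omega>, r)) \<in> measurable borel (Q \<Otimes>\<^sub>M borel)" by simp
    from measurable_compose[OF this m] have "(\<lambda>r. h (r, \<omega> r)) \<in> borel_measurable borel" by simp
    then show "(\<integral>\<^sup>+ r. h (snd (\<omega>, r), fst (\<omega>, r) (snd (\<omega>, r))) \<partial>L) = (\<integral>\<^sup>+ r\<in>{s..T}. h (r, \<omega> r) \<partial>lborel)"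
      by (simp add: nn_integral_interval_measure)
  qed
qed

lemma integrable_occupation_iff:
  fixes \<phi> :: "real \<times> 'e \<Rightarrow> real"
  assumes [measurable]: "\<phi> \<in> borel_measurable borel"
  shows "integrable (Q \<Otimes>\<^sub>M L) (\<lambda>z. (along \<phi> (fst z) (snd z))\<^sup>2) \<longleftrightarrow>
    (\<integral>\<^sup>+ \<omega>. (\<integral>\<^sup>+ r\<in>{s..T}. ennreal (\<bar>\<phi> (r, \<omega> r)\<bar> powr 2) \<partial>lborel) \<partial>Q) < \<infinity>"
proof -
  have [measurable]: "(\<lambda>z. along \<phi> (fst z) (snd z)) \<in> borel_measurable (Q \<Otimes>\<^sub>M L)" by measurable
  have "(\<integral>\<^sup>+ \<omega>. (\<integral>\<^sup>+ r\<in>{s..T}. ennreal (\<bar>\<phi> (r, \<omega> r)\<bar> powr 2) \<partial>lborel) \<partial>Q) =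
      (\<integral>\<^sup>+ z. ennreal ((along \<phi> (fst z) (snd z))\<^sup>2) \<partial>(Q \<Otimes>\<^sub>M L))"
    using nn_integral_occupation(1)[of "\<lambda>z. ennreal ((\<phi> z)\<^sup>2)"]
    by (simp add: abs_powr_two along_def)
  then show ?thesis
    by (simp add: integrable_iff_bounded)
qed

lemma zero_potential_AE:
  fixes A :: "(real \<times> 'e) set"
  assumes A: "A \<in> sets borel"
    and zero: "(\<integral>\<^sup>+ \<omega>. (\<integral>\<^sup>+ r\<in>{s..T}. indicator A (r, \<omega> r) \<partial>lborel) \<partial>Q) = 0"
  shows "AE z in Q \<Otimes>\<^sub>M L. (snd z, fst z (snd z)) \<notin> A"
proof -
  have m: "(indicator A :: _ \<Rightarrow> ennreal) \<in> borel_measurable borel" using A by simp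
  have "AE z in Q \<Otimes>\<^sub>M L. (indicator A (snd z, fst z (snd z)) :: ennreal) = 0"
    using zero nn_integral_0_iff_AE[OF nn_integral_occupation(2)[OF m]]
    unfolding nn_integral_occupation(1)[OF m, symmetric] by simp
  then show ?thesis by eventually_elim (simp add: indicator_eq_0_iff)
qed

text \<open>Fubini with the expectation inside. Together the three claims supply both clauses of
  \<open>trans_op_integrable\<close> and the value of the time integral.\<close>

lemma time_integral_of_expectation:
  fixes \<phi> :: "real \<times> 'e \<Rightarrow> real"
  assumes [measurable]: "\<phi> \<in> borel_measurable borel"
    and int: "integrable (Q \<Otimes>\<^sub>M L) (\<lambda>z. along \<phi> (fst z) (snd z))"
  shows "AE r in lborel. r \<in> {s..T} \<longrightarrow> integrable Q (\<lambda>\<omega>. \<phi> (r, \<omega> r))"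
    and "set_integrable lborel {s..T} (\<lambda>r. LINT \<omega>|Q. \<phi> (r, \<omega> r))"
    and "(LINT r:{s..T}|lborel. LINT \<omega>|Q. \<phi> (r, \<omega> r)) = (LINT z|(Q \<Otimes>\<^sub>M L). along \<phi> (fst z) (snd z))"
proof -
  have int': "integrable (Q \<Otimes>\<^sub>M L) (case_prod (along \<phi>))" using int by (simp add: case_prod_beta')
  have m: "(\<lambda>r. LINT \<omega>|Q. \<phi> (r, \<omega> r)) \<in> borel_measurable borel"
    unfolding along_def[symmetric] by measurable
  show "AE r in lborel. r \<in> {s..T} \<longrightarrow> integrable Q (\<lambda>\<omega>. \<phi> (r, \<omega> r))"
    using QL.AE_integrable_snd[OF int'] by (simp add: AE_interval_measure along_def)
  show "set_integrable lborel {s..T} (\<lambda>r. LINT \<omega>|Q. \<phi> (r, \<omega> r))"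
    using QL.integrable_snd[OF int'] by (simp add: set_integrable_interval_measure[OF m] along_def)
  show "(LINT r:{s..T}|lborel. LINT \<omega>|Q. \<phi> (r, \<omega> r)) = (LINT z|(Q \<Otimes>\<^sub>M L). along \<phi> (fst z) (snd z))"
    using QL.integral_snd[OF int'] by (simp add: set_integral_interval_measure[OF m] along_def case_prod_beta')
qed

text \<open>Here \<open>b\<close> stands for f(., ., 0, 0). Since the square root of
  \<open>G\<close> is square integrable over law and time, \<open>growth\<close> makes
  \<open>F\<close> so, and \<open>\<psi>F\<close> passes this to \<psi>. The two equations are then
  \<open>energy_identity\<close> with \<psi> replaced by \<open>- F\<close> and E[M_T^2] by the
  integral of \<open>G\<close>.\<close>

lemma identification_at:
  fixes u \<psi> F G :: "real \<times> 'e \<Rightarrow> real" and g :: "'e \<Rightarrow> real"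
  assumes [measurable]: "u \<in> borel_measurable borel" "\<psi> \<in> borel_measurable borel"
      "F \<in> borel_measurable borel" "b \<in> borel_measurable borel"
    and u2: "integrable (Q \<Otimes>\<^sub>M L) (\<lambda>z. (along u (fst z) (snd z))\<^sup>2)"
    and b2: "integrable (Q \<Otimes>\<^sub>M L) (\<lambda>z. (along b (fst z) (snd z))\<^sup>2)"
    and growth: "AE z in Q \<Otimes>\<^sub>M L. \<bar>along F (fst z) (snd z)\<bar> \<le>
       \<bar>along b (fst z) (snd z)\<bar> + C * (\<bar>along u (fst z) (snd z)\<bar> + sqrt (along G (fst z) (snd z)))"
    and \<psi>F: "AE z in Q \<Otimes>\<^sub>M L. along \<psi> (fst z) (snd z) = - along F (fst z) (snd z)"
    and mod: "martingale_modification T Q s x u \<psi> M"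
    and G: "bracket_density M G"
    and g2: "integrable Q (\<lambda>\<omega>. (g (\<omega> T))\<^sup>2)" and ug: "\<And>y. u (T, y) = g y"
  defines "H \<equiv> \<lambda>z. G z - 2 * u z * F z"
  shows "integrable Q (\<lambda>\<omega>. g (\<omega> T))"
    and "integrable (Q \<Otimes>\<^sub>M L) (\<lambda>z. along F (fst z) (snd z))"
    and "integrable (Q \<Otimes>\<^sub>M L) (\<lambda>z. along H (fst z) (snd z))"
    and "u (s, x) = (LINT \<omega>|Q. g (\<omega> T)) + (LINT z|(Q \<Otimes>\<^sub>M L). along F (fst z) (snd z))"
    and "(u (s, x))\<^sup>2 = (LINT \<omega>|Q. (g (\<omega> T))\<^sup>2) - (LINT z|(Q \<Otimes>\<^sub>M L). along H (fst z) (snd z))"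
proof -
  have Gm [measurable]: "G \<in> borel_measurable borel" and G0: "\<And>z. 0 \<le> G z"
    using G unfolding bracket_density_def by blast+
  have aG0: "0 \<le> along G \<omega> r" for \<omega> r by (simp add: along_def G0)
  have G1: "integrable (Q \<Otimes>\<^sub>M L) (\<lambda>z. along G (fst z) (snd z))"
    by (rule bracket_density_increments(1)[OF G])
  have gT: "g (\<omega> T) = along u \<omega> T" for \<omega> by (simp add: along_def ug)
  have "(\<lambda>\<omega>. g (\<omega> T)) \<in> borel_measurable Q" unfolding gT by measurable
  from square_integrable_imp_integrable[OF this g2] show "integrable Q (\<lambda>\<omega>. g (\<omega> T))" .
  have bound2: "integrable (Q \<Otimes>\<^sub>M L) (\<lambda>z. (\<bar>along b (fst z) (snd z)\<bar> +
      C * (\<bar>along u (fst z) (snd z)\<bar> + sqrt (along G (fst z) (snd z))))\<^sup>2)"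
  proof -
    have "integrable (Q \<Otimes>\<^sub>M L) (\<lambda>z. (\<bar>along u (fst z) (snd z)\<bar> + sqrt (along G (fst z) (snd z)))\<^sup>2)"
      using u2 G1 aG0 by (intro integrable_add_squares) auto
    then have "integrable (Q \<Otimes>\<^sub>M L) (\<lambda>z. (C * (\<bar>along u (fst z) (snd z)\<bar> + sqrt (along G (fst z) (snd z))))\<^sup>2)"
      by (simp add: power_mult_distrib)
    then show ?thesis using b2 by (intro integrable_add_squares) auto
  qed
  have F2: "integrable (Q \<Otimes>\<^sub>M L) (\<lambda>z. (along F (fst z) (snd z))\<^sup>2)"
  proof (rule Bochner_Integration.integrable_bound[OF bound2])
    show "AE z in Q \<Otimes>\<^sub>M L. norm ((along F (fst z) (snd z))\<^sup>2) \<le> norm ((\<bar>along b (fst z) (snd z)\<bar> +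
        C * (\<bar>along u (fst z) (snd z)\<bar> + sqrt (along G (fst z) (snd z))))\<^sup>2)"
      using growth
    proof eventually_elim
      case (elim z)
      from power_mono[OF this, of 2] show ?case by simp
    qed
  qed measurable
  have p2: "integrable (Q \<Otimes>\<^sub>M L) (\<lambda>z. (along \<psi> (fst z) (snd z))\<^sup>2)"
  proof (rule Bochner_Integration.integrable_bound[OF F2])
    show "AE z in Q \<Otimes>\<^sub>M L. norm ((along \<psi> (fst z) (snd z))\<^sup>2) \<le> norm ((along F (fst z) (snd z))\<^sup>2)"
      using \<psi>F by eventually_elim simp
  qed measurable
  show F1: "integrable (Q \<Otimes>\<^sub>M L) (\<lambda>z. along F (fst z) (snd z))"
    by (rule QL_finite.square_integrable_imp_integrable[OF _ F2]) measurable
  have uF: "integrable (Q \<Otimes>\<^sub>M L) (\<lambda>z. along F (fst z) (snd z) * along u (fst z) (snd z))"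
    by (intro integrable_mult_of_squares F2 u2) measurable
  have H: "along H \<omega> r = along G \<omega> r - 2 * (along F \<omega> r * along u \<omega> r)" for \<omega> r
    by (simp add: H_def along_def)
  show "integrable (Q \<Otimes>\<^sub>M L) (\<lambda>z. along H (fst z) (snd z))"
    unfolding H using G1 uF by simp
  have e1: "(LINT z|(Q \<Otimes>\<^sub>M L). along \<psi> (fst z) (snd z)) = (LINT z|(Q \<Otimes>\<^sub>M L). - along F (fst z) (snd z))"
    by (rule integral_cong_AE[OF _ _ \<psi>F]) measurable
  have e2: "(LINT z|(Q \<Otimes>\<^sub>M L). along \<psi> (fst z) (snd z) * along u (fst z) (snd z)) =
      (LINT z|(Q \<Otimes>\<^sub>M L). - (along F (fst z) (snd z) * along u (fst z) (snd z)))"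
  proof (rule integral_cong_AE)
    show "AE z in Q \<Otimes>\<^sub>M L. along \<psi> (fst z) (snd z) * along u (fst z) (snd z) =
        - (along F (fst z) (snd z) * along u (fst z) (snd z))"
      using \<psi>F by eventually_elim simp
  qed measurable
  note energy = energy_identity[OF _ _ u2 p2 mod]
  show "u (s, x) = (LINT \<omega>|Q. g (\<omega> T)) + (LINT z|(Q \<Otimes>\<^sub>M L). along F (fst z) (snd z))"
    unfolding gT using energy(1) e1 by simp
  show "(u (s, x))\<^sup>2 = (LINT \<omega>|Q. (g (\<omega> T))\<^sup>2) - (LINT z|(Q \<Otimes>\<^sub>M L). along H (fst z) (snd z))"
    unfolding gT H using energy(2) e2 G1 uF bracket_density_increments(2)[OF G] by simp
qed

end

section \<open>From one starting point to the whole family of laws\<close>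

lemma ext_carre_du_champ_bracket_density:
  assumes "canonical_start T s (P s x)" "ext_carre_du_champ T P u G" "ext_martingale T P u s x M"
  shows "canonical_start.bracket_density T s (P s x) M G"
proof -
  interpret canonical_start T s "P s x" by fact
  have "s \<in> {0..T}" using s_nonneg s_le_T by simp
  with assms(2,3) have "G \<in> borel_fun T" "\<forall>z. 0 \<le> G z" and
    "\<exists>A. angle_bracket T (P s x) M A \<and> (AE \<omega> in completion (P s x).
       path_integrable G s T \<omega> \<and> (\<forall>t\<in>{s..T}. A t \<omega> = path_integral G s t \<omega>))"
    unfolding ext_carre_du_champ_def by blast+
  moreover have "M \<in> H2_0 T (P s x)"
    using assms(3) by (auto simp: ext_martingale_def martingale_modification_def)
  ultimately show ?thesis
    by (simp add: bracket_density_def borel_fun_def)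
qed

text \<open>The carre du champ is rendered as a relation, so the first conjunct covers every version
  of it. The second needs some version to exist, and \<open>martingale_solution\<close> provides
  one.\<close>

theorem proposition3p7:
  fixes T C :: real
    and p :: "real \<Rightarrow> 'e::polish_space \<Rightarrow> real \<Rightarrow> 'e measure"
    and P :: "real \<Rightarrow> 'e \<Rightarrow> (real \<Rightarrow> 'e) measure"
    and D :: "(real \<times> 'e \<Rightarrow> real) set"
    and a :: "(real \<times> 'e \<Rightarrow> real) \<Rightarrow> (real \<times> 'e \<Rightarrow> real)"
    and f :: "real \<times> 'e \<times> real \<times> real \<Rightarrow> real"
    and g :: "'e \<Rightarrow> real"
    and u :: "real \<times> 'e \<Rightarrow> real"
  assumes "0 < T"
    and "transition_function T p"
    and "measurable_in_time T p"
    and "markov_canonical_class T p P"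
    and "linear_algebra_operator T D a"
    and "solves_martingale_problem T D a P"
    and "well_posed T D a P"
    and "f \<in> borel_fun T"
    and "g \<in> borel_measurable borel"
    and "0 < C"
    and "\<forall>s\<in>{0..T}. \<forall>x. integrable (P s x) (\<lambda>\<omega>. (g (\<omega> T))\<^sup>2)"
    and "(\<lambda>(t, x). f (t, x, 0, 0)) \<in> LpX T P 2"
    and "\<forall>t\<in>{0..T}. \<forall>x y z. \<bar>f (t, x, y, z)\<bar> \<le> \<bar>f (t, x, 0, 0)\<bar> + C * (\<bar>y\<bar> + \<bar>z\<bar>)"
    and "u \<in> LpX T P 2"
    and "martingale_solution T P f g u"
  shows "(\<forall>G. ext_carre_du_champ T P u G \<longrightarrow> IP_solution T P f g u (\<lambda>z. sqrt (G z)))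
    \<and> decoupled_mild_solution T P f g u"
proof -
  note markov = assms(4) and g2 = assms(11) and f0 = assms(12) and growth = assms(13) and u = assms(14)
  from assms(15) obtain \<psi> G\<^sub>0 where gen: "ext_generator T P u \<psi>" and G\<^sub>0: "ext_carre_du_champ T P u G\<^sub>0"
    and zero: "zero_potential T P {(t, x). t \<in> {0..T} \<and> \<psi> (t, x) \<noteq> - f (t, x, u (t, x), sqrt (G\<^sub>0 (t, x)))}"
    and ug: "\<And>x. u (T, x) = g x"
    unfolding martingale_solution_def by blast
  define b where "b = (\<lambda>(t, x). f (t, x, 0, 0))"
  have um [measurable]: "u \<in> borel_measurable borel" and pm [measurable]: "\<psi> \<in> borel_measurable borel"
    and bm [measurable]: "b \<in> borel_measurable borel" and fm: "f \<in> borel_measurable borel"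
    using gen f0 assms(8) by (auto simp: ext_generator_def borel_fun_def LpX_def b_def)
  have "IP_solution T P f g u (\<lambda>z. sqrt (G z))" if G: "ext_carre_du_champ T P u G" for G
  proof -
    have Gfun: "G \<in> borel_fun T" and Gm [measurable]: "G \<in> borel_measurable borel" and G0: "\<And>z. 0 \<le> G z"
      using G unfolding ext_carre_du_champ_def borel_fun_def by blast+
    define F where "F = (\<lambda>z. f (fst z, snd z, u z, sqrt (G z)))"
    have Fm [measurable]: "F \<in> borel_measurable borel"
    proof -
      have "(\<lambda>z. (fst z, snd z, u z, sqrt (G z))) \<in> borel_measurable borel"
        by (intro borel_measurable_Pair borel_measurable_continuous_onI[OF continuous_on_fst]
            borel_measurable_continuous_onI[OF continuous_on_snd] continuous_on_id) measurable
      from measurable_compose[OF this fm] show ?thesis by (simp add: F_def)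
    qed
    define H where "H = (\<lambda>z. G z - 2 * u z * F z)"
    have Hm [measurable]: "H \<in> borel_measurable borel" unfolding H_def by measurable
    have at: "canonical_start T s (P s x) \<and>
        (\<integral>\<^sup>+ \<omega>. (\<integral>\<^sup>+ r\<in>{s..T}. ennreal (\<bar>sqrt (G (r, \<omega> r))\<bar> powr 2) \<partial>lborel) \<partial>P s x) < \<infinity> \<and>
        trans_op_defined P s T g x \<and> trans_op_integrable P s T (\<lambda>r y. F (r, y)) x \<and>
        trans_op_integrable P s T (\<lambda>r y. H (r, y)) x \<and>
        u (s, x) = trans_op P s T g x + (LINT r:{s..T}|lborel. trans_op P s r (\<lambda>y. F (r, y)) x) \<and>
        (u (s, x))\<^sup>2 = trans_op P s T (\<lambda>y. (g y)\<^sup>2) x - (LINT r:{s..T}|lborel. trans_op P s r (\<lambda>y. H (r, y)) x)"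
      if s: "s \<in> {0..T}" for s x
    proof -
      have start: "canonical_start T s (P s x)"
        using markov s by (auto simp: canonical_start_def markov_canonical_class_def)
      interpret canonical_start T s "P s x" by (rule start)
      from gen s obtain M where mod: "martingale_modification T (P s x) s x u \<psi> M"
        unfolding ext_generator_def by blast
      with gen have M: "ext_martingale T P u s x M" by (auto simp: ext_martingale_def)
      \<comment> \<open>\<open>ext_carre_du_champ\<close> speaks of every version of the martingale
        part, so both densities can be taken for the same \<open>M\<close>.\<close>
      note dens = ext_carre_du_champ_bracket_density[OF start G M]
      note dens\<^sub>0 = ext_carre_du_champ_bracket_density[OF start G\<^sub>0 M]
      have u2: "integrable (P s x \<Otimes>\<^sub>M L) (\<lambda>z. (along u (fst z) (snd z))\<^sup>2)"
        using u s by (auto simp: integrable_occupation_iff LpX_def)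
      have b2: "integrable (P s x \<Otimes>\<^sub>M L) (\<lambda>z. (along b (fst z) (snd z))\<^sup>2)"
        using f0[folded b_def] s by (auto simp: integrable_occupation_iff LpX_def)
      \<comment> \<open>The growth bound and the equation for \<psi> are available only at times in
        \<open>[0,T]\<close>.\<close>
      have in_T: "AE z in P s x \<Otimes>\<^sub>M L. snd z \<in> {0..T}"
      proof (rule QL.AE_pair_measure)
        show "AE \<omega> in P s x. AE r in L. snd (\<omega>, r) \<in> {0..T}"
          using s by (intro AE_I2 eventually_mono[OF AE_interval_measure_in]) auto
      qed measurable
      have gr: "AE z in P s x \<Otimes>\<^sub>M L. \<bar>along F (fst z) (snd z)\<bar> \<le>
         \<bar>along b (fst z) (snd z)\<bar> + C * (\<bar>along u (fst z) (snd z)\<bar> + sqrt (along G (fst z) (snd z)))"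
        using in_T
      proof eventually_elim
        case (elim z)
        with growth have "\<bar>f (snd z, fst z (snd z), y, w)\<bar> \<le> \<bar>f (snd z, fst z (snd z), 0, 0)\<bar> + C * (\<bar>y\<bar> + \<bar>w\<bar>)" for y w
          by blast
        from this[of "u (snd z, fst z (snd z))" "sqrt (G (snd z, fst z (snd z)))"]
        show ?case using G0 by (simp add: along_def F_def b_def)
      qed
      have "AE z in P s x \<Otimes>\<^sub>M L. (snd z, fst z (snd z)) \<notin>
          {(t, x). t \<in> {0..T} \<and> \<psi> (t, x) \<noteq> - f (t, x, u (t, x), sqrt (G\<^sub>0 (t, x)))}"
        using zero s unfolding zero_potential_def by (intro zero_potential_AE) blast+
      \<comment> \<open>The equation holds with \<open>G\<^sub>0\<close>; along almost every path
        and time \<open>G\<^sub>0\<close> and \<open>G\<close> agree, so it holds with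
        \<open>F\<close>, which is built from \<open>G\<close>.\<close>
      with in_T bracket_density_unique[OF dens dens\<^sub>0]
      have \<psi>F: "AE z in P s x \<Otimes>\<^sub>M L. along \<psi> (fst z) (snd z) = - along F (fst z) (snd z)"
        by eventually_elim (auto simp: along_def F_def)
      have g2': "integrable (P s x) (\<lambda>\<omega>. (g (\<omega> T))\<^sup>2)" using g2 s by blast
      note ident = identification_at[OF um pm Fm bm u2 b2 gr \<psi>F mod dens g2' ug, folded H_def]
      note F_time = time_integral_of_expectation[OF Fm ident(2)]
      note H_time = time_integral_of_expectation[OF Hm ident(3)]
      have "integrable (P s x \<Otimes>\<^sub>M L) (\<lambda>z. (along (\<lambda>z. sqrt (G z)) (fst z) (snd z))\<^sup>2)"
        using bracket_density_increments(1)[OF dens] G0 by (simp add: along_def)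
      then have "(\<integral>\<^sup>+ \<omega>. (\<integral>\<^sup>+ r\<in>{s..T}. ennreal (\<bar>sqrt (G (r, \<omega> r))\<bar> powr 2) \<partial>lborel) \<partial>P s x) < \<infinity>"
        by (subst (asm) integrable_occupation_iff) auto
      with start ident(1,4,5) F_time H_time show ?thesis
        by (simp add: trans_op_defined_def trans_op_integrable_def trans_op_def)
    qed
    have "(\<lambda>z. sqrt (G z)) \<in> LpX T P 2"
      using at Gfun by (auto simp: LpX_def borel_fun_def)
    moreover have "\<forall>z. 0 \<le> sqrt (G z)" using G0 by simp
    moreover have "\<forall>s\<in>{0..T}. \<forall>x. trans_op_defined P s T (\<lambda>y. (g y)\<^sup>2) x"
      using g2 by (simp add: trans_op_defined_def)
    ultimately show ?thesis
      \<comment> \<open>\<open>H\<close> was formed with \<open>G\<close>, whereas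
        \<open>IP_solution\<close> asks for the square of its root; nonnegativity of
        \<open>G\<close> identifies them.\<close>
      using at[unfolded H_def F_def fst_conv snd_conv] u
      unfolding IP_solution_def Let_def real_sqrt_pow2[OF G0] by blast
  qed
  with G\<^sub>0 show ?thesis
    by (auto simp: decoupled_mild_solution_def)
qed

end
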